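(* Let $q\ge5$ be a prime power with $q\equiv\xi\pmod 3$, $\xi\in\{-1,0,1\}$, and let $\mathcal{C}_\mathscr{C}$ be the $[q+1,q-3,5]_q$ code with parity check matrix whose columns are the vectors $(1,t,t^2,t^3)$, $t\in\mathbb{F}_q$, and $(0,0,0,1)$. Then: (i) All weight-$1$ cosets of $\mathcal{C}_\mathscr{C}$ have the same weight distribution. (ii) If $\xi\ne1$, all weight-$2$ cosets have the same weight distribution. If $\xi=1$, there are exactly $2$ distinct weight distributions of weight-$2$ cosets, the numbers of corresponding cosets being $\frac13(q^3-q)(q-1)$ and $\frac16(q^3-q)(q-1)$. (iii) If $\xi=1$, there are exactly $2$ distinct weight distributions of weight-$3$ cosets, the numbers of corresponding cosets being $(q^2+q)(q-1)$ and $\frac12(q^3-q)(q-1)$. If $\xi=-1$, there are exactly $3$ distinct weight distributions of weight-$3$ cosets, the numbers of corresponding cosets being $(q^2+q)(q-1)$, $\frac13(q^3-q)(q-1)$ and $\frac16(q^3-q)(q-1)$. If $\xi=0$, there are exactly $2$ distinct weight distributions of weight-$3$ cosets, the numbers of corresponding cosets being $(q^2-1)(q-1)$ and $\frac12(q+1)(q^2-q+2)(q-1)$.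
   Context: A coset of a linear code $\mathcal{C}\subseteq\mathbb{F}_q^n$ is a set $\mathbf{v}+\mathcal{C}$; its weight is the minimum Hamming weight of its vectors; its weight distribution is the sequence $(B_w)_w$ where $B_w$ is the number of its vectors of Hamming weight $w$. *)

theory Defs
  imports Main
begin

text \<open>Coordinates of \<open>F_q^(q+1)\<close> are indexed by \<open>'a option\<close>:
  \<open>Some t\<close> is the column (1,t,t^2,t^3) for t in F_q, \<open>None\<close> is the column (0,0,0,1).\<close>

definition Hcol :: "'a::field option \<Rightarrow> nat \<Rightarrow> 'a" where
  "Hcol j k = (case j of None \<Rightarrow> (if k = 3 then 1 else 0) | Some t \<Rightarrow> t ^ k)"

definition twisted_cubic_code :: "('a::{finite,field} option \<Rightarrow> 'a) set" where
  "twisted_cubic_code = {c. \<forall>k<4. (\<Sum>j\<in>UNIV. Hcol j k * c j) = 0}"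

definition hweight :: "('i::finite \<Rightarrow> 'a::zero) \<Rightarrow> nat" where
  "hweight x = card {j. x j \<noteq> 0}"

definition coset :: "('i \<Rightarrow> 'a::plus) \<Rightarrow> ('i \<Rightarrow> 'a) set \<Rightarrow> ('i \<Rightarrow> 'a) set" where
  "coset v C = (\<lambda>c. (\<lambda>j. v j + c j)) ` C"

definition cosets :: "('i \<Rightarrow> 'a::plus) set \<Rightarrow> ('i \<Rightarrow> 'a) set set" where
  "cosets C = {coset v C | v. True}"

definition coset_weight :: "('i::finite \<Rightarrow> 'a::zero) set \<Rightarrow> nat" where
  "coset_weight S = Min (hweight ` S)"

definition weight_distribution :: "('i::finite \<Rightarrow> 'a::zero) set \<Rightarrow> nat \<Rightarrow> nat" where
  "weight_distribution S = (\<lambda>w. card {x \<in> S. hweight x = w})"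

definition cosets_of_weight :: "('i::finite \<Rightarrow> 'a::{zero,plus}) set \<Rightarrow> nat \<Rightarrow> ('i \<Rightarrow> 'a) set set" where
  "cosets_of_weight C w = {S \<in> cosets C. coset_weight S = w}"

definition distribution_counts :: "('i::finite \<Rightarrow> 'a::{zero,plus}) set \<Rightarrow> nat \<Rightarrow> nat list \<Rightarrow> bool" where
  "distribution_counts C w ns =
     (\<exists>Ds. distinct Ds \<and> set Ds = weight_distribution ` cosets_of_weight C w \<and>
        map (\<lambda>D. card {S \<in> cosets_of_weight C w. weight_distribution S = D}) Ds = ns)"

end

theory Submission
  imports Defs "HOL-Library.Product_Plus"
begin

text \<open>
  Cosets correspond to syndromes \<open>s\<close> in \<open>F_q^4\<close>. Any four columns of the parity check matrix are a
  basis, so the number of vectors of a coset supported in a set of at least four coordinates does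
  not depend on the coset; hence the weight distribution is determined by its entries of index at
  most 3, and for cosets of weight 2 or 3 by the entry of index 3 alone.

  A syndrome is a linear functional on binary cubic forms; polarising it gives a symmetric
  trilinear form \<open>pol s\<close> on the projective line, and three distinct columns span \<open>s\<close> iff \<open>pol s\<close>
  vanishes on them. The pairs \<open>i, j\<close> with \<open>pol s i j = 0\<close> identically are the roots of the Hessian of
  \<open>s\<close>, so off the cubic \<open>s\<close> lies on exactly one real chord (weight 2), tangent, or imaginary chord
  (weight 3). In each class, counting solutions of \<open>pol s i j k = 0\<close> expresses the entry of index 3
  through the number \<open>N = nroots s\<close> of roots of the cubic form \<open>pol s j j j\<close>.

  For characteristic other than 3, \<open>N = 2\<close> on tangents and \<open>N\<close> is 0, 1 or 3 on chords. The sums of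
  \<open>N\<close> and of \<open>N (N - 1)\<close> over all syndromes are found by double counting. On real chords the cubic
  form is diagonal, so \<open>N\<close> is governed by cube roots in \<open>F_q\<close>; the two sums then force the values of
  \<open>N\<close> on imaginary chords, without passing to \<open>F_(q^2)\<close>.
\<close>

section \<open>The trilinear form of a syndrome\<close>

text \<open>Homogeneous coordinates of the point of the projective line that indexes a column.\<close>

primrec hx :: "'a::field option \<Rightarrow> 'a" where
  "hx None = 0" | "hx (Some t) = 1"

primrec hy :: "'a::field option \<Rightarrow> 'a" where
  "hy None = 1" | "hy (Some t) = t"

text \<open>The determinant of two points. It is also the value at i of the linear form vanishing at
  j.\<close>

definition br :: "'a::field option \<Rightarrow> 'a option \<Rightarrow> 'a" where
  "br i j = hx i * hy j - hy i * hx j"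

lemma br_eq_0_iff [simp]: "br i j = 0 \<longleftrightarrow> i = j"
  by (cases i; cases j) (auto simp: br_def)

lemma br_self [simp]: "br i i = 0"
  by simp

lemma card_points: "card (UNIV :: 'a::finite option set) = card (UNIV :: 'a set) + 1"
  by (simp add: UNIV_option_conv card_image)

lemma ex1_projective_root:
  fixes a b :: "'a::field"
  assumes "a \<noteq> 0 \<or> b \<noteq> 0"
  shows "\<exists>!j. a * hx j + b * hy j = 0"
proof (cases "b = 0")
  case True
  with assms have a: "a \<noteq> 0" by simp
  show ?thesis
  proof (rule ex1I[of _ None])
    fix j assume "a * hx j + b * hy j = 0"
    with a True show "j = None" by (cases j) auto
  qed (use True in auto)
next
  case False
  show ?thesis
  proof (rule ex1I[of _ "Some (- a / b)"])
    fix j assume "a * hx j + b * hy j = 0"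
    with False show "j = Some (- a / b)"
      by (cases j) (auto simp: field_simps add_eq_0_iff)
  qed (use False in auto)
qed

type_synonym 'a syndrome = "'a \<times> 'a \<times> 'a \<times> 'a"

text \<open>\<open>pol s i j k\<close> is the value at \<open>l_i l_j l_k\<close> of the functional sending \<open>X^(3-e) Y^e\<close> to \<open>s_e\<close>, where
  \<open>l_j = hy j X - hx j Y\<close> is the linear form vanishing at \<open>j\<close>.\<close>

fun pol :: "'a::field syndrome \<Rightarrow> 'a option \<Rightarrow> 'a option \<Rightarrow> 'a option \<Rightarrow> 'a" where
  "pol (s0, s1, s2, s3) i j k =
     hy i * hy j * hy k * s0
     - (hx i * hy j * hy k + hy i * hx j * hy k + hy i * hy j * hx k) * s1
     + (hx i * hx j * hy k + hx i * hy j * hx k + hy i * hx j * hx k) * s2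
     - hx i * hx j * hx k * s3"

lemma pol_commute: "pol s i j k = pol s j i k" "pol s i j k = pol s i k j"
  by (cases s; simp add: algebra_simps)+

text \<open>Classical apolarity of s to the quadratic form with roots i and j: s lies in the span of
  the columns i and j, or for \<open>i = j\<close> in the tangent at i.\<close>

definition apolar :: "'a::field syndrome \<Rightarrow> 'a option \<Rightarrow> 'a option \<Rightarrow> bool" where
  "apolar s i j \<longleftrightarrow> (\<forall>k. pol s i j k = 0)"

lemma apolar_commute: "apolar s i j \<longleftrightarrow> apolar s j i"
  by (simp add: apolar_def pol_commute(1)[of s i j])

lemma pol_linear:
  obtains a b where "\<And>k. pol s i j k = a * hx k + b * hy k"
proof -
  obtain s0 s1 s2 s3 where s: "s = (s0, s1, s2, s3)" by (cases s)
  show thesis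
    by (rule that[of "- hy i * hy j * s1 + (hx i * hy j + hy i * hx j) * s2 - hx i * hx j * s3"
        "hy i * hy j * s0 - (hx i * hy j + hy i * hx j) * s1 + hx i * hx j * s2"])
      (simp add: s algebra_simps)
qed

lemma ex1_pol_root:
  assumes "\<not> apolar s i j"
  shows "\<exists>!k. pol s i j k = 0"
proof -
  obtain a b where ab: "\<And>k. pol s i j k = a * hx k + b * hy k" by (rule pol_linear[of s i j]) blast
  with assms have "a \<noteq> 0 \<or> b \<noteq> 0" by (auto simp: apolar_def)
  from ex1_projective_root[OF this] show ?thesis by (simp add: ab)
qed

text \<open>In its last argument \<open>pol s i j\<close> is a linear form, so a second root makes
  it vanish identically.\<close>

lemma apolarI:
  assumes "pol s i j k = 0" "pol s i j l = 0" "k \<noteq> l"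
  shows "apolar s i j"
  using ex1_pol_root[of s i j] assms by blast

section \<open>Syndromes of vectors as functionals on binary cubic forms\<close>

definition syn :: "('a::{finite,field} option \<Rightarrow> 'a) \<Rightarrow> 'a syndrome" where
  "syn x = (\<Sum>j\<in>UNIV. Hcol j 0 * x j, \<Sum>j\<in>UNIV. Hcol j 1 * x j,
            \<Sum>j\<in>UNIV. Hcol j 2 * x j, \<Sum>j\<in>UNIV. Hcol j 3 * x j)"

lemma Hcol_hx_hy:
  "Hcol j 0 = hx j ^ 3" "Hcol j (Suc 0) = hx j ^ 2 * hy j" "Hcol j 2 = hx j * hy j ^ 2" "Hcol j 3 = hy j ^ 3"
  by (cases j; simp add: Hcol_def)+

text \<open>Column m is evaluation of cubic forms at the point m, and there the form with roots i,
  j, k takes the value \<open>br m i * br m j * br m k\<close>.\<close>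

lemma pol_syn: "pol (syn x) i j k = (\<Sum>m\<in>UNIV. x m * (br m i * br m j * br m k))"
  unfolding syn_def pol.simps sum_distrib_left sum_subtractf[symmetric] sum.distrib[symmetric]
  by (rule sum.cong) (auto simp: Hcol_hx_hy br_def power2_eq_square power3_eq_cube algebra_simps)

lemma syn_diff: "syn (\<lambda>j. x j - y j) = syn x - syn y"
  by (simp add: syn_def right_diff_distrib sum_subtractf)

lemma syn_add: "syn (\<lambda>j. x j + y j) = syn x + syn y"
  by (simp add: syn_def distrib_left sum.distrib)

lemma twisted_cubic_code_eq: "twisted_cubic_code = {c. syn c = 0}"
proof -
  have "(\<forall>k<4. P k) \<longleftrightarrow> P 0 \<and> P 1 \<and> P 2 \<and> P (3::nat)" for P
    by (auto simp: less_Suc_eq numeral_eq_Suc)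
  then show ?thesis by (simp add: twisted_cubic_code_def syn_def zero_prod_def)
qed

section \<open>Spanning by few columns\<close>

definition supp :: "('i \<Rightarrow> 'a::zero) \<Rightarrow> 'i set" where
  "supp x = {j. x j \<noteq> 0}"

lemma hweight_supp: "hweight x = card (supp x)"
  by (simp add: hweight_def supp_def)

definition single :: "'i \<Rightarrow> 'a::zero \<Rightarrow> 'i \<Rightarrow> 'a" where
  "single a c = (\<lambda>m. if m = a then c else 0)"

lemma supp_single: "supp (single a c) = (if c = 0 then {} else {a})"
  by (auto simp: supp_def single_def)

lemma pol_add: "pol (s + t) i j k = pol s i j k + pol t i j k"
  by (cases s; cases t) (simp add: algebra_simps)

lemma pol_zero [simp]: "pol 0 i j k = 0"
  by (simp add: zero_prod_def)

lemma pol_syn_single: "pol (syn (single a c)) i j k = c * (br a i * br a j * br a k)"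
proof -
  have "pol (syn (single a c)) i j k =
     (\<Sum>m\<in>UNIV. if m = a then c * (br a i * br a j * br a k) else 0)"
    unfolding pol_syn by (rule sum.cong) (auto simp: single_def)
  then show ?thesis by simp
qed

lemma syn_zero: "syn (\<lambda>_. 0) = 0"
  by (simp add: syn_def zero_prod_def)

text \<open>Pairing with the cubic form that vanishes at three of the four points isolates the
  coefficient of the remaining column. The coefficient map on F_q^4 is thus injective, and by
  finiteness surjective.\<close>

lemma syn_spans4:
  fixes s :: "'a::{finite,field} syndrome"
  assumes d: "distinct [a, b, c, d]"
  obtains \<alpha> \<beta> \<gamma> \<delta> where
    "s = syn (single a \<alpha>) + syn (single b \<beta>) + syn (single c \<gamma>) + syn (single d \<delta>)"
proof -
  define T where "T = (\<lambda>(\<alpha>, \<beta>, \<gamma>, \<delta>).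
    syn (single a \<alpha>) + syn (single b \<beta>) + syn (single c \<gamma>) + syn (single d \<delta>))"
  have "inj T"
  proof (rule injI)
    fix u v :: "'a \<times> 'a \<times> 'a \<times> 'a" assume "T u = T v"
    then have "pol (T u) i j k = pol (T v) i j k" for i j k by simp
    from this[of b c d] this[of a c d] this[of a b d] this[of a b c] show "u = v"
      using d by (cases u; cases v) (auto simp: T_def pol_add pol_syn_single)
  qed
  then have "surj T" by (simp add: finite_UNIV_inj_surj)
  then obtain u where "s = T u" by (metis surjD)
  then show thesis by (cases u) (auto simp: T_def intro: that)
qed

lemma ex_point_notin:
  fixes A :: "'a::{finite,field} option set"
  assumes "card (UNIV :: 'a set) \<ge> 5" "card A \<le> 5"
  obtains d where "d \<notin> A"
proof -
  from assms card_points[where 'a = 'a] have "A \<noteq> UNIV" by auto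
  then show thesis using that by auto
qed

text \<open>Expand s in a, b, c and a fourth column e. Pairing with the cubic form vanishing at a,
  b, c leaves a nonzero multiple of the coefficient at e.\<close>

lemma span3_of_pol_eq_0:
  fixes s :: "'a::{finite,field} syndrome"
  assumes q: "card (UNIV :: 'a set) \<ge> 5"
    and d: "distinct [a, b, c]" and p: "pol s a b c = 0"
  obtains \<alpha> \<beta> \<gamma> where "s = syn (single a \<alpha>) + syn (single b \<beta>) + syn (single c \<gamma>)"
proof -
  obtain e where "e \<notin> {a, b, c}"
    by (rule ex_point_notin[OF q, of "{a, b, c}"]) (auto simp: card_insert_if)
  with d have "distinct [a, b, c, e]" by auto
  from syn_spans4[OF this] obtain \<alpha> \<beta> \<gamma> \<delta> where
    s: "s = syn (single a \<alpha>) + syn (single b \<beta>) + syn (single c \<gamma>) + syn (single e \<delta>)" .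
  with p \<open>distinct [a, b, c, e]\<close> have "\<delta> = 0" by (auto simp: pol_add pol_syn_single)
  with s have "s = syn (single a \<alpha>) + syn (single b \<beta>) + syn (single c \<gamma>)"
    by (simp add: single_def syn_zero)
  then show thesis by (rule that)
qed

lemma span2_of_apolar:
  fixes s :: "'a::{finite,field} syndrome"
  assumes q: "card (UNIV :: 'a set) \<ge> 5" and d: "a \<noteq> b" and p: "apolar s a b"
  obtains \<alpha> \<beta> where "s = syn (single a \<alpha>) + syn (single b \<beta>)"
proof -
  obtain e where e: "e \<notin> {a, b}"
    by (rule ex_point_notin[OF q, of "{a, b}"]) (auto simp: card_insert_if)
  \<comment> \<open>The form with roots a, b, f does not vanish at e, so \<open>pol s a b f\<close>
    detects the coefficient of column e.\<close>
  obtain f where f: "f \<notin> {a, b, e}"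
    by (rule ex_point_notin[OF q, of "{a, b, e}"]) (auto simp: card_insert_if)
  from e f d have "distinct [a, b, e]" by auto
  from span3_of_pol_eq_0[OF q this, of s] p[unfolded apolar_def] obtain \<alpha> \<beta> \<gamma> where
    s: "s = syn (single a \<alpha>) + syn (single b \<beta>) + syn (single e \<gamma>)" by blast
  have "pol s a b f = 0" using p by (simp add: apolar_def)
  with s e f have "\<gamma> = 0" by (auto simp: pol_add pol_syn_single)
  with s have "s = syn (single a \<alpha>) + syn (single b \<beta>)"
    by (simp add: single_def syn_zero)
  then show thesis by (rule that)
qed

text \<open>The minimum distance is at least 5: pad the other support points of z to three points
  avoiding m. The cubic form vanishing at them picks out \<open>z m\<close> from the zero
  syndrome.\<close>

lemma min_distance:
  fixes z :: "'a::{finite,field} option \<Rightarrow> 'a"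
  assumes q: "card (UNIV :: 'a set) \<ge> 5" and z: "syn z = 0" and c: "card (supp z) \<le> 4"
  shows "z = (\<lambda>_. 0)"
proof (rule ccontr)
  assume "z \<noteq> (\<lambda>_. 0)"
  then obtain m where m: "z m \<noteq> 0" by auto
  have "card (supp z - {m}) \<le> 3" using m c by (auto simp: supp_def)
  moreover have "card (UNIV - {m}) \<ge> 3" using q by (simp add: card_points)
  ultimately obtain B where B: "supp z - {m} \<subseteq> B" "B \<subseteq> UNIV - {m}" "card B = 3"
    using exists_subset_between[of "supp z - {m}" 3 "UNIV - {m}"] by auto
  then obtain i j k where ijk: "B = {i, j, k}" by (auto simp: card_3_iff)
  have "0 = pol (syn z) i j k" using z by simp
  also have "\<dots> = (\<Sum>n\<in>UNIV. if n = m then z m * (br m i * br m j * br m k) else 0)"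
    unfolding pol_syn using B ijk by (intro sum.cong) (auto simp: supp_def)
  also have "\<dots> = z m * (br m i * br m j * br m k)" by simp
  finally show False using m B ijk by auto
qed

lemma syn_eq_imp_eq:
  fixes x y :: "'a::{finite,field} option \<Rightarrow> 'a"
  assumes q: "card (UNIV :: 'a set) \<ge> 5" and eq: "syn x = syn y" and c: "card (supp x \<union> supp y) \<le> 4"
  shows "x = y"
proof -
  have "supp (\<lambda>j. x j - y j) \<subseteq> supp x \<union> supp y" by (auto simp: supp_def)
  then have "card (supp (\<lambda>j. x j - y j)) \<le> card (supp x \<union> supp y)" by (rule card_mono[rotated]) simp
  with c have "card (supp (\<lambda>j. x j - y j)) \<le> 4" by simp
  then have "(\<lambda>j. x j - y j) = (\<lambda>_. 0)"
    using min_distance[OF q, of "\<lambda>j. x j - y j"] eq by (simp add: syn_diff)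
  then show ?thesis by (auto simp: fun_eq_iff)
qed

lemma syn_eq_imp_eq_hweight:
  fixes x y :: "'a::{finite,field} option \<Rightarrow> 'a"
  assumes "card (UNIV :: 'a set) \<ge> 5" "syn x = syn y" "hweight x + hweight y \<le> 4"
  shows "x = y"
  using assms card_Un_le[of "supp x" "supp y"] by (intro syn_eq_imp_eq) (auto simp: hweight_supp)

section \<open>Cosets as fibres of the syndrome map\<close>

definition fib :: "'a::{finite,field} syndrome \<Rightarrow> ('a option \<Rightarrow> 'a) set" where
  "fib s = {x. syn x = s}"

lemma coset_eq_fib: "coset v twisted_cubic_code = fib (syn v)"
proof
  show "coset v twisted_cubic_code \<subseteq> fib (syn v)"
    by (auto simp: coset_def fib_def twisted_cubic_code_eq syn_add)
  show "fib (syn v) \<subseteq> coset v twisted_cubic_code"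
  proof
    fix x assume "x \<in> fib (syn v)"
    then have "(\<lambda>j. x j - v j) \<in> twisted_cubic_code" "x = (\<lambda>j. v j + (x j - v j))"
      by (auto simp: fib_def twisted_cubic_code_eq syn_diff)
    then show "x \<in> coset v twisted_cubic_code" unfolding coset_def by (intro image_eqI)
  qed
qed

lemma ex_syn_supported:
  fixes s :: "'a::{finite,field} syndrome"
  assumes "card J \<ge> 4"
  obtains x where "syn x = s" "supp x \<subseteq> J"
proof -
  obtain K where K: "K \<subseteq> J" "card K = 4" using assms by (meson obtain_subset_with_card_n)
  then obtain xs where xs: "set xs = K" "distinct xs" "length xs = 4"
    by (metis card.infinite distinct_card finite_distinct_list zero_neq_numeral)
  then obtain a b c d where abcd: "xs = [a, b, c, d]"
    by (auto simp: numeral_eq_Suc length_Suc_conv)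
  with xs have "distinct [a, b, c, d]" by simp
  from syn_spans4[OF this] obtain \<alpha> \<beta> \<gamma> \<delta> where
    s: "s = syn (single a \<alpha>) + syn (single b \<beta>) + syn (single c \<gamma>) + syn (single d \<delta>)" .
  let ?x = "\<lambda>m. single a \<alpha> m + single b \<beta> m + single c \<gamma> m + single d \<delta> m"
  show thesis
  proof (rule that[of ?x])
    show "syn ?x = s" by (simp only: syn_add s)
    show "supp ?x \<subseteq> J" using K xs abcd by (auto simp: supp_def single_def split: if_splits)
  qed
qed

lemma surj_syn:
  assumes q: "card (UNIV :: 'a::{finite,field} set) \<ge> 5"
  shows "surj (syn :: ('a option \<Rightarrow> 'a) \<Rightarrow> 'a syndrome)"
proof -
  have "card (UNIV :: 'a option set) \<ge> 4" using q by (simp add: card_points)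
  then show ?thesis unfolding surj_def using ex_syn_supported[OF \<open>card (UNIV :: 'a option set) \<ge> 4\<close>] by (metis (no_types))
qed

lemma inj_fib:
  assumes q: "card (UNIV :: 'a::{finite,field} set) \<ge> 5"
  shows "inj (fib :: 'a syndrome \<Rightarrow> _)"
proof (rule injI)
  fix s t :: "'a syndrome" assume eq: "fib s = fib t"
  obtain x where "s = syn x" using surjD[OF surj_syn[OF q]] by blast
  then have "x \<in> fib t" unfolding eq[symmetric] by (simp add: fib_def)
  with \<open>s = syn x\<close> show "s = t" by (simp add: fib_def)
qed

lemma cosets_of_weight_eq:
  assumes q: "card (UNIV :: 'a::{finite,field} set) \<ge> 5"
  shows "cosets_of_weight (twisted_cubic_code :: ('a option \<Rightarrow> 'a) set) w =
    fib ` {s. coset_weight (fib s) = w}"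
proof -
  have "cosets (twisted_cubic_code :: ('a option \<Rightarrow> 'a) set) = range fib"
    using surj_syn[OF q] by (auto simp: cosets_def coset_eq_fib surj_def) metis
  then show ?thesis by (auto simp: cosets_of_weight_def)
qed

section \<open>Weight distributions\<close>

declare split_paired_All [simp del] split_paired_Ex [simp del]

lemma sum_indicator_eq_card:
  assumes "finite S"
  shows "(\<Sum>x\<in>S. if P x then 1 else 0) = card {x \<in> S. P x}"
  using sum.inter_filter[OF assms, of "\<lambda>_. 1 :: nat" P] by simp

text \<open>Four columns inside J already span, so the fibre contains some x0 supported in J.
  Translation by x0 matches the two sets.\<close>

lemma card_fib_supported:
  fixes s :: "'a::{finite,field} syndrome"
  assumes "card J \<ge> 4"
  shows "card {x \<in> fib s. supp x \<subseteq> J} = card {x \<in> fib 0. supp x \<subseteq> J}"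
proof -
  obtain x0 where x0: "syn x0 = s" "supp x0 \<subseteq> J" using ex_syn_supported[OF assms] .
  have "bij_betw (\<lambda>x j. x j - x0 j) {x \<in> fib s. supp x \<subseteq> J} {x \<in> fib 0. supp x \<subseteq> J}"
    by (rule bij_betw_byWitness[where f' = "\<lambda>x j. x j + x0 j"])
      (use x0 in \<open>force simp: fib_def syn_diff syn_add supp_def\<close>)+
  then show ?thesis by (rule bij_betw_same_card)
qed

lemma card_supersets:
  fixes K :: "'i::finite set"
  assumes "card K \<le> m"
  shows "card {J. card J = m \<and> K \<subseteq> J} = (card (UNIV :: 'i set) - card K) choose (m - card K)"
proof -
  have "bij_betw (\<lambda>J. J - K) {J. card J = m \<and> K \<subseteq> J} {L. L \<subseteq> - K \<and> card L = m - card K}"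
    by (rule bij_betw_byWitness[where f' = "\<lambda>L. L \<union> K"])
      (use assms in \<open>auto simp: card_Diff_subset card_Un_disjoint disjoint_eq_subset_Compl\<close>)
  then have "card {J. card J = m \<and> K \<subseteq> J} = card {L. L \<subseteq> - K \<and> card L = m - card K}"
    by (rule bij_betw_same_card)
  also have "\<dots> = card (- K) choose (m - card K)" by (rule n_subsets) simp
  finally show ?thesis by (simp add: Compl_eq_Diff_UNIV card_Diff_subset)
qed

text \<open>Double counting of the pairs of a vector x in S and an m-set J containing its
  support.\<close>

lemma weight_distribution_moment:
  fixes S :: "('i::finite \<Rightarrow> 'a::{finite,zero}) set"
  shows "(\<Sum>J | card J = m. card {x \<in> S. supp x \<subseteq> J}) =
    (\<Sum>w\<le>m. weight_distribution S w * ((card (UNIV :: 'i set) - w) choose (m - w)))"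
proof -
  have "(\<Sum>J | card J = m. card {x \<in> S. supp x \<subseteq> J}) =
      (\<Sum>J | card J = m. \<Sum>x\<in>S. if supp x \<subseteq> J then 1 else 0)"
    by (simp add: sum_indicator_eq_card)
  also have "\<dots> = (\<Sum>x\<in>S. \<Sum>J | card J = m. if supp x \<subseteq> J then 1 else 0)"
    by (rule sum.swap)
  also have "\<dots> = (\<Sum>x\<in>S. card {J. card J = m \<and> supp x \<subseteq> J})"
    by (simp add: sum_indicator_eq_card)
  also have "\<dots> = (\<Sum>x | x \<in> S \<and> hweight x \<le> m. card {J. card J = m \<and> supp x \<subseteq> J})"
  proof (rule sum.mono_neutral_right)
    show "\<forall>x\<in>S - {x \<in> S. hweight x \<le> m}. card {J. card J = m \<and> supp x \<subseteq> J} = 0"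
      by (auto simp: hweight_supp card_eq_0_iff dest: card_mono[rotated])
  qed auto
  also have "\<dots> = (\<Sum>x | x \<in> S \<and> hweight x \<le> m. (card (UNIV :: 'i set) - hweight x) choose (m - hweight x))"
    by (rule sum.cong) (auto simp: hweight_supp card_supersets)
  also have "\<dots> = (\<Sum>w\<le>m. \<Sum>x | x \<in> {x \<in> S. hweight x \<le> m} \<and> hweight x = w.
      (card (UNIV :: 'i set) - hweight x) choose (m - hweight x))"
    by (rule sum.group[symmetric]) auto
  also have "\<dots> = (\<Sum>w\<le>m. weight_distribution S w * ((card (UNIV :: 'i set) - w) choose (m - w)))"
  proof (rule sum.cong)
    fix w assume "w \<in> {..m}"
    then have "{x. x \<in> {x \<in> S. hweight x \<le> m} \<and> hweight x = w} = {x \<in> S. hweight x = w}" by auto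
    then show "(\<Sum>x | x \<in> {x \<in> S. hweight x \<le> m} \<and> hweight x = w.
      (card (UNIV :: 'i set) - hweight x) choose (m - hweight x)) =
      weight_distribution S w * ((card (UNIV :: 'i set) - w) choose (m - w))"
      by (simp add: weight_distribution_def)
  qed simp
  finally show ?thesis .
qed

text \<open>For \<open>m > 3\<close> the moment of index m is the same for every fibre. The moment
  identities are triangular with coefficient 1 at \<open>w = m\<close>, so the entries are
  determined recursively from those of index at most 3.\<close>

lemma weight_distribution_fib_eqI:
  fixes s t :: "'a::{finite,field} syndrome"
  assumes le3: "\<And>w. w \<le> 3 \<Longrightarrow> weight_distribution (fib s) w = weight_distribution (fib t) w"
  shows "weight_distribution (fib s) = weight_distribution (fib t)"
proof
  fix m
  show "weight_distribution (fib s) m = weight_distribution (fib t) m"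
  proof (induction m rule: less_induct)
    case (less m)
    show ?case
    proof (cases "m \<le> 3")
      case True
      then show ?thesis by (rule le3)
    next
      case False
      let ?c = "\<lambda>w. (card (UNIV :: 'a option set) - w) choose (m - w)"
      have "(\<Sum>J | card J = m. card {x \<in> fib s. supp x \<subseteq> J}) =
          (\<Sum>J | card J = m. card {x \<in> fib t. supp x \<subseteq> J})"
        by (rule sum.cong) (use False in \<open>auto simp: card_fib_supported[of _ s] card_fib_supported[of _ t]\<close>)
      then have "(\<Sum>w\<le>m. weight_distribution (fib s) w * ?c w) = (\<Sum>w\<le>m. weight_distribution (fib t) w * ?c w)"
        by (simp only: weight_distribution_moment)
      moreover have "(\<Sum>w<m. weight_distribution (fib s) w * ?c w) = (\<Sum>w<m. weight_distribution (fib t) w * ?c w)"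
        by (rule sum.cong) (auto simp: less.IH)
      ultimately show ?thesis by (simp add: lessThan_Suc_atMost[symmetric])
    qed
  qed
qed

section \<open>Coset weights read off the syndrome\<close>

definition low :: "'a::{finite,field} syndrome set" where
  "low = {s. \<exists>x. syn x = s \<and> hweight x \<le> 1}"

definition secant :: "'a::{finite,field} syndrome set" where
  "secant = {s. \<exists>x. syn x = s \<and> hweight x = 2}"

lemma coset_weight_fib_attained:
  fixes s :: "'a::{finite,field} syndrome"
  assumes q: "card (UNIV :: 'a set) \<ge> 5"
  obtains x where "syn x = s" "hweight x = coset_weight (fib s)"
proof -
  have "fib s \<noteq> {}" using surjD[OF surj_syn[OF q], of s] by (auto simp: fib_def)
  then have "coset_weight (fib s) \<in> hweight ` fib s" unfolding coset_weight_def by (intro Min_in) auto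
  then show thesis using that by (auto simp: fib_def)
qed

lemma coset_weight_fib_le: "syn x = s \<Longrightarrow> coset_weight (fib s) \<le> hweight x"
  unfolding coset_weight_def by (intro Min_le) (auto simp: fib_def)

text \<open>A vector of least weight in the coset differs from x by a codeword of weight at most 4,
  hence equals x.\<close>

lemma coset_weight_fib_eq:
  fixes x :: "'a::{finite,field} option \<Rightarrow> 'a"
  assumes q: "card (UNIV :: 'a set) \<ge> 5" and x: "syn x = s" "hweight x \<le> 2"
  shows "coset_weight (fib s) = hweight x"
proof -
  obtain y where y: "syn y = s" "hweight y = coset_weight (fib s)" using coset_weight_fib_attained[OF q] .
  with coset_weight_fib_le[OF x(1)] x have "hweight x + hweight y \<le> 4" by simp
  with x y have "x = y" using q by (intro syn_eq_imp_eq_hweight) auto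
  with y show ?thesis by simp
qed

lemma coset_weight_fib_eq_2_iff:
  fixes s :: "'a::{finite,field} syndrome"
  assumes q: "card (UNIV :: 'a set) \<ge> 5"
  shows "coset_weight (fib s) = 2 \<longleftrightarrow> s \<in> secant"
proof
  assume "coset_weight (fib s) = 2"
  then show "s \<in> secant"
    by (metis (mono_tags) coset_weight_fib_attained[OF q] secant_def mem_Collect_eq)
qed (auto simp: secant_def coset_weight_fib_eq[OF q])

text \<open>The positivity condition rules out weights above 3. It is established later by counting
  triples of columns.\<close>

lemma coset_weight_fib_eq_3_iff:
  fixes s :: "'a::{finite,field} syndrome"
  assumes q: "card (UNIV :: 'a set) \<ge> 5"
  shows "coset_weight (fib s) = 3 \<longleftrightarrow> s \<notin> low \<and> s \<notin> secant \<and> weight_distribution (fib s) 3 > 0"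
proof
  assume w: "coset_weight (fib s) = 3"
  obtain x where x: "syn x = s" "hweight x = 3" using coset_weight_fib_attained[OF q, of s] w by metis
  have "s \<notin> low \<and> s \<notin> secant" using w coset_weight_fib_le[of _ s] by (fastforce simp: low_def secant_def)
  moreover have "x \<in> {x \<in> fib s. hweight x = 3}" using x by (simp add: fib_def)
  then have "weight_distribution (fib s) 3 > 0" by (auto simp: weight_distribution_def card_gt_0_iff)
  ultimately show "s \<notin> low \<and> s \<notin> secant \<and> weight_distribution (fib s) 3 > 0" by simp
next
  assume r: "s \<notin> low \<and> s \<notin> secant \<and> weight_distribution (fib s) 3 > 0"
  then obtain x where x: "syn x = s" "hweight x = 3"
    by (auto simp: weight_distribution_def card_gt_0_iff fib_def)
  obtain y where y: "syn y = s" "hweight y = coset_weight (fib s)" using coset_weight_fib_attained[OF q] .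
  have "\<not> hweight y \<le> 1" "hweight y \<noteq> 2" using y r by (auto simp: low_def secant_def)
  with y coset_weight_fib_le[OF x(1)] x show "coset_weight (fib s) = 3" by linarith
qed

lemma low_secant_disjoint:
  assumes q: "card (UNIV :: 'a::{finite,field} set) \<ge> 5"
  shows "(low :: 'a syndrome set) \<inter> secant = {}"
proof -
  have False if s: "s \<in> low" "s \<in> secant" for s :: "'a syndrome"
  proof -
    obtain x where x: "syn x = s" "hweight x \<le> 1" using s by (auto simp: low_def)
    moreover have "coset_weight (fib s) = 2" using that coset_weight_fib_eq_2_iff[OF q] by simp
    ultimately show False using coset_weight_fib_le[OF x(1)] by simp
  qed
  then show ?thesis by blast
qed

lemma weight_distribution_unique:
  fixes x :: "'a::{finite,field} option \<Rightarrow> 'a"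
  assumes q: "card (UNIV :: 'a set) \<ge> 5" and x: "syn x = s" "hweight x + w \<le> 4"
  shows "weight_distribution (fib s) w = (if w = hweight x then 1 else 0)"
proof -
  have "{y \<in> fib s. hweight y = w} = (if w = hweight x then {x} else {})"
    using x syn_eq_imp_eq_hweight[OF q, of x] by (auto simp: fib_def) metis+
  then show ?thesis by (simp add: weight_distribution_def)
qed

lemma weight_distribution_coset_weight_1:
  fixes s t :: "'a::{finite,field} syndrome"
  assumes q: "card (UNIV :: 'a set) \<ge> 5" and "coset_weight (fib s) = 1" "coset_weight (fib t) = 1"
  shows "weight_distribution (fib s) = weight_distribution (fib t)"
proof -
  obtain x where x: "syn x = s" "hweight x = 1" using coset_weight_fib_attained[OF q, of s] assms by metis
  obtain y where y: "syn y = t" "hweight y = 1" using coset_weight_fib_attained[OF q, of t] assms by metis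
  show ?thesis
    by (rule weight_distribution_fib_eqI)
      (simp add: weight_distribution_unique[OF q x(1)] weight_distribution_unique[OF q y(1)] x y)
qed

lemma weight_distribution_eq_iff:
  fixes s t :: "'a::{finite,field} syndrome"
  assumes q: "card (UNIV :: 'a set) \<ge> 5" and w: "w = 2 \<or> w = 3"
    and st: "coset_weight (fib s) = w" "coset_weight (fib t) = w"
  shows "weight_distribution (fib s) = weight_distribution (fib t) \<longleftrightarrow>
    weight_distribution (fib s) 3 = weight_distribution (fib t) 3"
proof
  assume eq3: "weight_distribution (fib s) 3 = weight_distribution (fib t) 3"
  have small: "weight_distribution (fib u) v = (if w = 2 \<and> v = 2 then 1 else 0)"
    if u: "coset_weight (fib u) = w" and v: "v < 3" for u :: "'a syndrome" and v
  proof (cases "w = 2")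
    case True
    obtain x where "syn x = u" "hweight x = 2" using coset_weight_fib_attained[OF q, of u] u True by metis
    with v True show ?thesis by (simp add: weight_distribution_unique[OF q, of x])
  next
    case False
    with w u have "coset_weight (fib u) = 3" by simp
    with v have "{x \<in> fib u. hweight x = v} = {}"
      using coset_weight_fib_le[of _ u] by (fastforce simp: fib_def)
    with False show ?thesis by (simp add: weight_distribution_def)
  qed
  show "weight_distribution (fib s) = weight_distribution (fib t)"
  proof (rule weight_distribution_fib_eqI)
    fix v :: nat assume "v \<le> 3"
    then consider "v < 3" | "v = 3" by linarith
    then show "weight_distribution (fib s) v = weight_distribution (fib t) v"
      by cases (simp_all add: small st eq3)
  qed
qed simp

text \<open>On W the invariant g separates the weight distributions, and \<open>fib\<close> is
  injective, so level sets of g among syndromes count cosets. The factor 6 fits g to a count of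
  ordered triples of columns.\<close>

lemma distribution_countsI:
  fixes g :: "'a::{finite,field} syndrome \<Rightarrow> nat"
  assumes q: "card (UNIV :: 'a set) \<ge> 5" and w: "w = 2 \<or> w = 3"
    and W: "\<And>s. s \<in> W \<longleftrightarrow> coset_weight (fib s) = w"
    and g: "\<And>s. s \<in> W \<Longrightarrow> g s = 6 * weight_distribution (fib s) 3"
    and vs: "distinct vs" "g ` W = set vs" "map (\<lambda>v. card {s \<in> W. g s = v}) vs = ns"
  shows "distribution_counts (twisted_cubic_code :: ('a option \<Rightarrow> 'a) set) w ns"
proof -
  have giff: "weight_distribution (fib s) = weight_distribution (fib t) \<longleftrightarrow> g s = g t" if "s \<in> W" "t \<in> W" for s t
    using weight_distribution_eq_iff[OF q w, of s t] that W g by auto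
  \<comment> \<open>One representative syndrome for each value of g. The distributions of their
    fibres form the list \<open>Ds\<close>.\<close>
  define r where "r v = (SOME s. s \<in> W \<and> g s = v)" for v
  have r: "r v \<in> W \<and> g (r v) = v" if "v \<in> set vs" for v
  proof -
    have "v \<in> g ` W" using that vs(2) by simp
    then obtain s where "s \<in> W \<and> g s = v" by blast
    then show ?thesis unfolding r_def by (rule someI)
  qed
  define Ds where "Ds = map (\<lambda>v. weight_distribution (fib (r v))) vs"
  have cw: "cosets_of_weight (twisted_cubic_code :: ('a option \<Rightarrow> 'a) set) w = fib ` W"
    unfolding cosets_of_weight_eq[OF q] using W by auto
  have "distinct Ds"
  proof -
    have "inj_on (\<lambda>v. weight_distribution (fib (r v))) (set vs)"
    proof (rule inj_onI)
      fix u v assume uv: "u \<in> set vs" "v \<in> set vs"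
        "weight_distribution (fib (r u)) = weight_distribution (fib (r v))"
      then have "g (r u) = g (r v)" using giff r by simp
      with r uv show "u = v" by simp
    qed
    with vs(1) show ?thesis by (simp add: Ds_def distinct_map)
  qed
  moreover have "set Ds = weight_distribution ` cosets_of_weight (twisted_cubic_code :: ('a option \<Rightarrow> 'a) set) w"
  proof -
    have "weight_distribution (fib s) \<in> set Ds" if "s \<in> W" for s
    proof -
      have gs: "g s \<in> set vs" using that vs(2) by blast
      then have "weight_distribution (fib s) = weight_distribution (fib (r (g s)))"
        using r[OF gs] giff[of s "r (g s)"] that by simp
      with gs show ?thesis by (simp add: Ds_def)
    qed
    then show ?thesis unfolding cw using r by (auto simp: Ds_def)
  qed
  moreover have "card {S \<in> fib ` W. weight_distribution S = weight_distribution (fib (r v))} = card {s \<in> W. g s = v}"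
    if "v \<in> set vs" for v
  proof -
    have "{S \<in> fib ` W. weight_distribution S = weight_distribution (fib (r v))} =
        fib ` {s \<in> W. weight_distribution (fib s) = weight_distribution (fib (r v))}" by blast
    also have "{s \<in> W. weight_distribution (fib s) = weight_distribution (fib (r v))} = {s \<in> W. g s = v}"
      using giff[of _ "r v"] r[OF that] by (intro Collect_cong conj_cong) simp_all
    finally have "{S \<in> fib ` W. weight_distribution S = weight_distribution (fib (r v))} = fib ` {s \<in> W. g s = v}" .
    then show ?thesis by (simp add: card_image inj_on_subset[OF inj_fib[OF q] subset_UNIV])
  qed
  then have "map (\<lambda>D. card {S \<in> fib ` W. weight_distribution S = D}) Ds = ns"
    using vs(3) by (auto simp: Ds_def)
  ultimately show ?thesis unfolding distribution_counts_def cw by blast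
qed

section \<open>Chords and tangents\<close>

lemma card_triples_of_3_set:
  assumes "card J = 3"
  shows "card {(i, j, k). distinct [i, j, k] \<and> {i, j, k} = J} = 6"
proof -
  obtain a b c where J: "J = {a, b, c}" "a \<noteq> b" "b \<noteq> c" "a \<noteq> c" using assms by (auto simp: card_3_iff)
  have "distinct [i, j, k] \<and> {i, j, k} = J \<longleftrightarrow> distinct [i, j, k] \<and> i \<in> J \<and> j \<in> J \<and> k \<in> J" for i j k
    using card_subset_eq[of J "{i, j, k}"] assms card_gt_0_iff[of J] by (auto simp: card_insert_if)
  then have "{(i, j, k). distinct [i, j, k] \<and> {i, j, k} = J} =
      {(i, j, k). distinct [i, j, k] \<and> i \<in> J \<and> j \<in> J \<and> k \<in> J}" by simp
  also have "\<dots> = {(a, b, c), (a, c, b), (b, a, c), (b, c, a), (c, a, b), (c, b, a)}"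
    using J by auto
  also have "card \<dots> = 6" using J by simp
  finally show ?thesis .
qed

text \<open>The vanishing of \<open>pol\<close> puts s in the span of the three columns. The three
  conditions on pairs say that none of the three coefficients is zero.\<close>

definition triples :: "'a::{finite,field} syndrome \<Rightarrow> ('a option \<times> 'a option \<times> 'a option) set" where
  "triples s = {(i, j, k). distinct [i, j, k] \<and> pol s i j k = 0 \<and>
     \<not> apolar s i j \<and> \<not> apolar s i k \<and> \<not> apolar s j k}"

lemma triples_iff_ex_supp:
  fixes s :: "'a::{finite,field} syndrome"
  assumes q: "card (UNIV :: 'a set) \<ge> 5"
  shows "(i, j, k) \<in> triples s \<longleftrightarrow> distinct [i, j, k] \<and> (\<exists>x. syn x = s \<and> supp x = {i, j, k})"
    (is "_ \<longleftrightarrow> ?R")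
proof
  assume t: "(i, j, k) \<in> triples s"
  then have d: "distinct [i, j, k]" and p: "pol s i j k = 0"
    and n: "\<not> apolar s i j" "\<not> apolar s i k" "\<not> apolar s j k"
    by (auto simp: triples_def)
  from span3_of_pol_eq_0[OF q d p] obtain \<alpha> \<beta> \<gamma> where
    s: "s = syn (single i \<alpha>) + syn (single j \<beta>) + syn (single k \<gamma>)" .
  have "\<alpha> \<noteq> 0" "\<beta> \<noteq> 0" "\<gamma> \<noteq> 0"
    using n by (auto simp: apolar_def s pol_add pol_syn_single)
  then have "supp (\<lambda>m. single i \<alpha> m + single j \<beta> m + single k \<gamma> m) = {i, j, k}"
    using d by (auto simp: supp_def single_def)
  moreover have "syn (\<lambda>m. single i \<alpha> m + single j \<beta> m + single k \<gamma> m) = s"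
    by (simp only: syn_add s)
  ultimately show ?R using d by blast
next
  assume ?R
  then obtain x where d: "distinct [i, j, k]" and x: "syn x = s" "supp x = {i, j, k}" by blast
  have "pol s i j k = 0"
    unfolding x(1)[symmetric] pol_syn using x(2) by (intro sum.neutral) (auto simp: supp_def)
  moreover have "\<not> apolar s a b" if ab: "a \<in> {i, j, k}" "b \<in> {i, j, k}" "a \<noteq> b" for a b
  proof
    \<comment> \<open>This would give a vector of weight at most 2 with the same syndrome, supported
      inside the support of x, and therefore equal to x.\<close>
    assume "apolar s a b"
    from span2_of_apolar[OF q ab(3) this] obtain \<alpha> \<beta> where "s = syn (single a \<alpha>) + syn (single b \<beta>)" .
    then have sy: "syn x = syn (\<lambda>m. single a \<alpha> m + single b \<beta> m)" by (simp only: x syn_add)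
    have sub: "supp (\<lambda>m. single a \<alpha> m + single b \<beta> m) \<subseteq> {a, b}"
      by (auto simp: supp_def single_def)
    then have "supp x \<union> supp (\<lambda>m. single a \<alpha> m + single b \<beta> m) = {i, j, k}" using x ab by auto
    moreover have "card {i, j, k} \<le> 4" by (simp add: card_insert_if)
    ultimately have "x = (\<lambda>m. single a \<alpha> m + single b \<beta> m)" using syn_eq_imp_eq[OF q sy] by simp
    with sub x have "{i, j, k} \<subseteq> {a, b}" by simp
    then have "card {i, j, k} \<le> card {a, b}" by (rule card_mono[rotated]) simp
    with d ab show False by simp
  qed
  ultimately show "(i, j, k) \<in> triples s" using d by (auto simp: triples_def)
qed

text \<open>A vector of weight 3 in the fibre is determined by its support, since a difference of
  two with equal support has weight at most 3. Each support has six orderings.\<close>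

lemma card_triples:
  fixes s :: "'a::{finite,field} syndrome"
  assumes q: "card (UNIV :: 'a set) \<ge> 5"
  shows "card (triples s) = 6 * weight_distribution (fib s) 3"
proof -
  let ?X = "{x \<in> fib s. hweight x = 3}"
  let ?t = "\<lambda>x. {(i, j, k). distinct [i, j, k] \<and> {i, j, k} = supp x}"
  have "triples s = (\<Union>x\<in>?X. ?t x)"
  proof (rule set_eqI)
    fix p :: "'a option \<times> 'a option \<times> 'a option"
    obtain i j k where p: "p = (i, j, k)" by (cases p)
    have "distinct [i, j, k] \<Longrightarrow> card {i, j, k} = 3" by simp
    then show "p \<in> triples s \<longleftrightarrow> p \<in> (\<Union>x\<in>?X. ?t x)"
      unfolding p triples_iff_ex_supp[OF q] by (auto simp: fib_def hweight_supp simp del: distinct.simps)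
  qed
  also have "card \<dots> = (\<Sum>x\<in>?X. card (?t x))"
  proof (rule card_UN_disjoint)
    show "\<forall>x\<in>?X. \<forall>y\<in>?X. x \<noteq> y \<longrightarrow> ?t x \<inter> ?t y = {}"
    proof (intro ballI impI)
      fix x y assume xy: "x \<in> ?X" "y \<in> ?X" "x \<noteq> y"
      have "supp x \<noteq> supp y"
        using syn_eq_imp_eq[OF q, of x y] xy by (auto simp: fib_def hweight_supp)
      then show "?t x \<inter> ?t y = {}" by auto
    qed
  qed auto
  also have "\<dots> = (\<Sum>x\<in>?X. 6)"
    by (rule sum.cong) (auto simp: hweight_supp card_triples_of_3_set simp del: distinct.simps)
  finally show ?thesis by (simp add: weight_distribution_def)
qed

text \<open>The coefficients are the minors of the \<open>2 \<times> 3\<close> catalecticant matrix of \<open>s\<close>, whose kernel consists of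
  the quadratic forms that annihilate \<open>s\<close>.\<close>

fun hess :: "'a::field syndrome \<Rightarrow> 'a option \<Rightarrow> 'a" where
  "hess (s0, s1, s2, s3) j =
     (s1 * s3 - s2 * s2) * hx j * hx j + (s1 * s2 - s0 * s3) * hx j * hy j + (s0 * s2 - s1 * s1) * hy j * hy j"

section \<open>Uniqueness of the chord or tangent through a point off the cubic\<close>

lemma apolar_iff:
  "apolar (s0, s1, s2, s3) i j \<longleftrightarrow>
     hy i * hy j * s0 - (hx i * hy j + hy i * hx j) * s1 + hx i * hx j * s2 = 0 \<and>
     hy i * hy j * s1 - (hx i * hy j + hy i * hx j) * s2 + hx i * hx j * s3 = 0" (is "_ \<longleftrightarrow> ?A = 0 \<and> ?B = 0")
proof -
  have pol: "pol (s0, s1, s2, s3) i j k = hy k * ?A - hx k * ?B" for k by (simp add: algebra_simps)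
  \<comment> \<open>\<open>None\<close> and \<open>Some 0\<close> have coordinates (0, 1) and (1,
    0), so they read off the two coefficients.\<close>
  show ?thesis
    unfolding apolar_def pol by (auto dest: spec[of _ None] spec[of _ "Some 0"])
qed

lemma syn_single: "syn (single a c) = (hx a ^ 3 * c, hx a ^ 2 * hy a * c, hx a * hy a ^ 2 * c, hy a ^ 3 * c)"
  by (simp add: syn_def single_def Hcol_hx_hy if_distrib sum.delta cong: if_cong)

lemma lowI: "s = syn (single a c) \<Longrightarrow> s \<in> low"
  by (auto simp: low_def hweight_supp supp_single intro!: exI[of _ "single a c"])

lemma low_iff:
  fixes s :: "'a::{finite,field} syndrome"
  shows "s \<in> low \<longleftrightarrow> (\<exists>a c. s = syn (single a c))"
proof
  assume "s \<in> low"
  then obtain x where x: "syn x = s" "card (supp x) \<le> 1" by (auto simp: low_def hweight_supp)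
  then obtain a where "supp x \<subseteq> {a}"
    by (metis card_le_Suc0_iff_eq One_nat_def finite insertCI subsetI empty_iff)
  then have "x = single a (x a)" by (auto simp: single_def supp_def fun_eq_iff)
  with x show "\<exists>a c. s = syn (single a c)" by metis
qed (auto intro: lowI)

text \<open>These quadrics cut out the twisted cubic: they make the coordinates a geometric
  progression of ratio \<open>s1 / s0\<close>, or, if \<open>s0 = 0\<close>, leave only the last
  one.\<close>

lemma low_of_minors:
  assumes "s1 * s3 = s2 * s2" "s1 * s2 = s0 * s3" "s0 * s2 = s1 * s1"
  shows "(s0, s1, s2, s3) \<in> low"
proof (cases "s0 = 0")
  case True
  with assms have "s1 = 0" "s2 = 0" by auto
  with True show ?thesis by (intro lowI[of _ None s3]) (simp add: syn_single)
next
  case False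
  then have "s2 = s1 * s1 / s0" using assms by (simp add: field_simps)
  moreover have "s3 = s1 * s2 / s0" using assms False by (simp add: field_simps)
  ultimately show ?thesis
    using False by (intro lowI[of _ "Some (s1 / s0)" s0])
      (simp add: syn_single power2_eq_square power3_eq_cube field_simps)
qed

text \<open>Off the cubic the catalecticant matrix has rank 2, so its kernel is one-dimensional and
  spanned by its minors. Hence the quadratic form with roots i and j, with coefficients
  \<open>p0\<close>, \<open>p1\<close>, \<open>p2\<close>, is proportional to the Hessian.\<close>

lemma apolar_pair_eq_hess_roots:
  fixes s :: "'a::{finite,field} syndrome"
  assumes s: "s \<notin> low" and ap: "apolar s i j"
  shows "{i, j} = {k. hess s k = 0}"
proof -
  obtain s0 s1 s2 s3 where s4: "s = (s0, s1, s2, s3)" by (cases s)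
  define p0 p1 p2 where "p0 = hy i * hy j" and "p1 = - (hx i * hy j + hy i * hx j)" and "p2 = hx i * hx j"
  define q0 q1 q2 where "q0 = s1 * s3 - s2 * s2" and "q1 = s1 * s2 - s0 * s3" and "q2 = s0 * s2 - s1 * s1"
  have e: "p0 * s0 + p1 * s1 + p2 * s2 = 0" "p0 * s1 + p1 * s2 + p2 * s3 = 0"
    using ap by (simp_all add: s4 apolar_iff p0_def p1_def p2_def algebra_simps)
  have par: "p0 * q1 = p1 * q0" "p0 * q2 = p2 * q0" "p1 * q2 = p2 * q1"
    unfolding q0_def q1_def q2_def using e by algebra+
  have qne: "q0 \<noteq> 0 \<or> q1 \<noteq> 0 \<or> q2 \<noteq> 0"
    using s low_of_minors[of s1 s3 s2 s0] by (auto simp: s4 q0_def q1_def q2_def)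
  have pne: "p0 \<noteq> 0 \<or> p1 \<noteq> 0 \<or> p2 \<noteq> 0"
    by (cases i; cases j) (auto simp: p0_def p1_def p2_def)
  have "hess s k = 0 \<longleftrightarrow> p0 * hx k * hx k + p1 * hx k * hy k + p2 * hy k * hy k = 0" (is "?h = 0 \<longleftrightarrow> ?p = 0") for k
  proof -
    have h: "?h = q0 * hx k * hx k + q1 * hx k * hy k + q2 * hy k * hy k"
      by (simp add: s4 q0_def q1_def q2_def)
    \<comment> \<open>Proportionality is used cross-multiplied; a nonzero coefficient on each side
      carries zeros both ways.\<close>
    have "?h * p0 = ?p * q0" "?h * p1 = ?p * q1" "?h * p2 = ?p * q2"
      unfolding h using par by algebra+
    with pne qne show ?thesis by (metis mult_eq_0_iff)
  qed
  moreover have "p0 * hx k * hx k + p1 * hx k * hy k + p2 * hy k * hy k = br i k * br j k" for k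
    by (simp add: p0_def p1_def p2_def br_def algebra_simps)
  ultimately show ?thesis by auto
qed

text \<open>Both pairs are the root set of the Hessian. Geometrically, real chords and tangents do
  not meet off the cubic.\<close>

lemma apolar_unique:
  fixes s :: "'a::{finite,field} syndrome"
  assumes "s \<notin> low" "apolar s i j" "apolar s k l"
  shows "{i, j} = {k, l}"
  using apolar_pair_eq_hess_roots assms by blast

lemma secant_iff:
  fixes s :: "'a::{finite,field} syndrome"
  assumes q: "card (UNIV :: 'a set) \<ge> 5"
  shows "s \<in> secant \<longleftrightarrow> s \<notin> low \<and> (\<exists>a b. a \<noteq> b \<and> apolar s a b)"
proof
  assume s: "s \<in> secant"
  then obtain x where x: "syn x = s" "card (supp x) = 2" by (auto simp: secant_def hweight_supp)
  then obtain a b where ab: "supp x = {a, b}" "a \<noteq> b" by (auto simp: card_2_iff)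
  have "apolar s a b"
    unfolding x(1)[symmetric] apolar_def pol_syn using ab by (auto intro!: sum.neutral simp: supp_def)
  with ab s low_secant_disjoint[OF q] show "s \<notin> low \<and> (\<exists>a b. a \<noteq> b \<and> apolar s a b)" by blast
next
  assume r: "s \<notin> low \<and> (\<exists>a b. a \<noteq> b \<and> apolar s a b)"
  then obtain a b where ab: "a \<noteq> b" "apolar s a b" by blast
  from span2_of_apolar[OF q this] obtain \<alpha> \<beta> where s: "s = syn (single a \<alpha>) + syn (single b \<beta>)" .
  have "\<alpha> \<noteq> 0" "\<beta> \<noteq> 0" using r s lowI[of s b \<beta>] lowI[of s a \<alpha>] by (auto simp: single_def syn_zero)
  then have "supp (\<lambda>m. single a \<alpha> m + single b \<beta> m) = {a, b}"
    using ab by (auto simp: supp_def single_def)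
  moreover have "syn (\<lambda>m. single a \<alpha> m + single b \<beta> m) = s" by (simp only: syn_add s)
  ultimately show "s \<in> secant"
    using ab unfolding secant_def hweight_supp by (intro CollectI exI[of _ "\<lambda>m. single a \<alpha> m + single b \<beta> m"]) simp
qed

section \<open>The four classes of syndromes\<close>

definition tangent :: "'a::{finite,field} syndrome set" where
  "tangent = {s. s \<notin> low \<and> (\<exists>a. apolar s a a)}"

text \<open>The points whose Hessian has no root over F_q, that is, those on chords joining
  conjugate points over F_(q^2). Defining them by exclusion keeps the extension field out.\<close>

definition imaginary :: "'a::{finite,field} syndrome set" where
  "imaginary = {s. s \<notin> low \<and> (\<forall>a b. \<not> apolar s a b)}"

lemma classes_disjoint:
  assumes q: "card (UNIV :: 'a::{finite,field} set) \<ge> 5"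
  shows "(low :: 'a syndrome set) \<inter> tangent = {}" "(low :: 'a syndrome set) \<inter> imaginary = {}"
    "(secant :: 'a syndrome set) \<inter> tangent = {}" "(secant :: 'a syndrome set) \<inter> imaginary = {}"
    "(tangent :: 'a syndrome set) \<inter> imaginary = {}"
proof -
  have "\<not> (s \<in> secant \<and> s \<in> tangent)" for s :: "'a syndrome"
  proof
    assume "s \<in> secant \<and> s \<in> tangent"
    then obtain a b c where "s \<notin> low" "a \<noteq> b" "apolar s a b" "apolar s c c"
      unfolding secant_iff[OF q] tangent_def by blast
    with apolar_unique[of s a b c c] show False by auto
  qed
  then show "(secant :: 'a syndrome set) \<inter> tangent = {}" by blast
  show "(low :: 'a syndrome set) \<inter> tangent = {}" "(low :: 'a syndrome set) \<inter> imaginary = {}"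
    "(tangent :: 'a syndrome set) \<inter> imaginary = {}"
    by (auto simp: tangent_def imaginary_def)
  show "(secant :: 'a syndrome set) \<inter> imaginary = {}"
    by (auto simp: imaginary_def secant_iff[OF q])
qed

lemma classes_cover:
  fixes s :: "'a::{finite,field} syndrome"
  assumes q: "card (UNIV :: 'a set) \<ge> 5"
  shows "s \<in> low \<or> s \<in> secant \<or> s \<in> tangent \<or> s \<in> imaginary"
  unfolding tangent_def imaginary_def secant_iff[OF q] mem_Collect_eq by metis

section \<open>Counting triples of columns\<close>

lemma card_eq_of_ex1:
  assumes "finite A" and "\<And>a. a \<in> A \<Longrightarrow> \<exists>!b. Q a b"
  shows "card {(a, b). a \<in> A \<and> Q a b} = card A"
proof -
  have "{(a, b). a \<in> A \<and> Q a b} = (\<lambda>a. (a, THE b. Q a b)) ` A"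
  proof (intro set_eqI iffI)
    fix p assume "p \<in> (\<lambda>a. (a, THE b. Q a b)) ` A"
    then show "p \<in> {(a, b). a \<in> A \<and> Q a b}" using theI'[OF assms(2)] by auto
  qed (use assms(2) in \<open>auto simp: image_iff the1_equality\<close>)
  then show ?thesis by (simp add: card_image inj_on_def)
qed

text \<open>Each i has one partner j with \<open>P i i j\<close>, and the partner is i itself
  exactly when \<open>P i i i\<close>.\<close>

lemma card_diagonal_pairs:
  assumes "finite R" and "\<And>i. i \<in> R \<Longrightarrow> \<exists>!j. j \<in> R \<and> P i i j"
  shows "card {(i, j). i \<in> R \<and> j \<in> R \<and> i \<noteq> j \<and> P i i j} + card {i \<in> R. P i i i} = card R"
proof -
  have "card R = card {(i, j). i \<in> R \<and> j \<in> R \<and> P i i j}"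
    using card_eq_of_ex1[of R "\<lambda>i j. j \<in> R \<and> P i i j"] assms by simp
  also have "{(i, j). i \<in> R \<and> j \<in> R \<and> P i i j} =
      {(i, j). i \<in> R \<and> j \<in> R \<and> i \<noteq> j \<and> P i i j} \<union> (\<lambda>i. (i, i)) ` {i \<in> R. P i i i}" by auto
  also have "card \<dots> = card {(i, j). i \<in> R \<and> j \<in> R \<and> i \<noteq> j \<and> P i i j} + card ((\<lambda>i. (i, i)) ` {i \<in> R. P i i i})"
    using assms(1) by (intro card_Un_disjoint) (auto intro: finite_subset[of _ "R \<times> R"])
  also have "card ((\<lambda>i. (i, i)) ` {i \<in> R. P i i i}) = card {i \<in> R. P i i i}"
    by (simp add: card_image inj_on_def)
  finally show ?thesis by simp
qed

lemma card_distinct_pairs: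
  assumes "finite R"
  shows "card {(i, j). i \<in> R \<and> j \<in> R \<and> i \<noteq> j} = card R * (card R - 1)"
proof -
  have "{(i, j). i \<in> R \<and> j \<in> R \<and> i \<noteq> j} = (SIGMA i:R. R - {i})" by auto
  then show ?thesis using assms by (simp add: card_SigmaI)
qed

text \<open>Every ordered pair of distinct i, j has one third point k. Either k is new, or it equals
  i or j; by symmetry each of the two degenerate cases is counted by the pairs with
  \<open>P i i j\<close>.\<close>

lemma card_distinct_triples:
  assumes fin: "finite R"
    and sym: "\<And>i j k. P i j k \<longleftrightarrow> P j i k" "\<And>i j k. P i j k \<longleftrightarrow> P i k j"
    and ex1: "\<And>i j. i \<in> R \<Longrightarrow> j \<in> R \<Longrightarrow> i \<noteq> j \<Longrightarrow> \<exists>!k. k \<in> R \<and> P i j k"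
  shows "card {(i, j, k). i \<in> R \<and> j \<in> R \<and> k \<in> R \<and> distinct [i, j, k] \<and> P i j k}
      + 2 * card {(i, j). i \<in> R \<and> j \<in> R \<and> i \<noteq> j \<and> P i i j} = card R * (card R - 1)"
proof -
  let ?O = "{(i, j). i \<in> R \<and> j \<in> R \<and> i \<noteq> j}"
  let ?X = "{(p, k). p \<in> ?O \<and> (case p of (i, j) \<Rightarrow> k \<in> R \<and> P i j k)}"
  let ?T = "{(i, j, k). i \<in> R \<and> j \<in> R \<and> k \<in> R \<and> distinct [i, j, k] \<and> P i j k}"
  let ?E = "{(i, j). i \<in> R \<and> j \<in> R \<and> i \<noteq> j \<and> P i i j}"
  have finE: "finite ?E" by (rule finite_subset[of _ "R \<times> R"]) (use fin in auto)
  have finT: "finite ?T" by (rule finite_subset[of _ "R \<times> R \<times> R"]) (use fin in auto)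
  have finO: "finite ?O" by (rule finite_subset[of _ "R \<times> R"]) (use fin in auto)
  have "card ?X = card ?O"
  proof (rule card_eq_of_ex1[OF finO])
    fix p assume "p \<in> ?O"
    then obtain i j where "p = (i, j)" "i \<in> R" "j \<in> R" "i \<noteq> j" by auto
    with ex1[of i j] show "\<exists>!k. case p of (i, j) \<Rightarrow> k \<in> R \<and> P i j k" by simp
  qed
  moreover have "?X = (\<lambda>(i, j, k). ((i, j), k)) ` ?T \<union>
     ((\<lambda>(i, j). ((i, j), i)) ` ?E \<union> (\<lambda>(i, j). ((j, i), i)) ` ?E)" (is "_ = ?A \<union> (?B \<union> ?C)")
  proof -
    have iij: "P i j i \<longleftrightarrow> P i i j" "P i j j \<longleftrightarrow> P j j i" for i j using sym by blast+
    show ?thesis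
    proof (intro set_eqI iffI)
      fix p assume "p \<in> ?X"
      then obtain i j k where p: "p = ((i, j), k)" "i \<in> R" "j \<in> R" "k \<in> R" "i \<noteq> j" "P i j k" by auto
      then consider "k = i" | "k = j" | "distinct [i, j, k]" by auto
      then show "p \<in> ?A \<union> (?B \<union> ?C)"
      proof cases
        case 1
        with p iij have "p \<in> ?B" by (intro rev_image_eqI[of "(i, j)"]) auto
        then show ?thesis by blast
      next
        case 2
        with p iij have "p \<in> ?C" by (intro rev_image_eqI[of "(j, i)"]) auto
        then show ?thesis by blast
      next
        case 3
        with p have "p \<in> ?A" by (intro rev_image_eqI[of "(i, j, k)"]) auto
        then show ?thesis by blast
      qed
    next
      fix p assume "p \<in> ?A \<union> (?B \<union> ?C)"
      then show "p \<in> ?X" using iij by auto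
    qed
  qed
  moreover have "card (?A \<union> (?B \<union> ?C)) = card ?A + (card ?B + card ?C)"
    using finE finT by (subst card_Un_disjoint, auto)+
  moreover have "card ?A = card ?T" by (rule card_image) (auto simp: inj_on_def)
  moreover have "card ?B = card ?E" by (rule card_image) (auto simp: inj_on_def)
  moreover have "card ?C = card ?E" by (rule card_image) (auto simp: inj_on_def)
  ultimately show ?thesis using card_distinct_pairs[OF fin] by simp
qed

definition nroots :: "'a::{finite,field} syndrome \<Rightarrow> nat" where
  "nroots s = card {j. pol s j j j = 0}"

lemma pol_sym_eq_0: "pol s i j k = 0 \<longleftrightarrow> pol s j i k = 0" "pol s i j k = 0 \<longleftrightarrow> pol s i k j = 0"
  using pol_commute[of s i j k] by auto

lemma card_triples_of_no_secant:
  fixes s :: "'a::{finite,field} syndrome"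
  assumes "\<And>i j. i \<noteq> j \<Longrightarrow> \<not> apolar s i j"
  shows "card (triples s) + 2 * card {(i, j). i \<noteq> j \<and> pol s i i j = 0} =
    (card (UNIV :: 'a set) + 1) * card (UNIV :: 'a set)"
proof -
  have "triples s = {(i, j, k). distinct [i, j, k] \<and> pol s i j k = 0}"
    using assms by (auto simp: triples_def)
  then show ?thesis
    using card_distinct_triples[of UNIV "\<lambda>i j k. pol s i j k = 0"] pol_sym_eq_0[of s] ex1_pol_root[OF assms]
    by (simp add: card_points)
qed

lemma double_count_arith: "e + n = m \<Longrightarrow> t + 2 * e = p \<Longrightarrow> t + 2 * m = p + 2 * n" for e n m t p :: nat
  by linarith

text \<open>No pair is apolar, so every one of the q + 1 points i has a unique j with
  \<open>pol s i i j = 0\<close>; it is i itself at the \<open>nroots s\<close> roots.\<close>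

lemma card_triples_imaginary:
  fixes s :: "'a::{finite,field} syndrome"
  assumes "s \<in> imaginary"
  defines "q \<equiv> card (UNIV :: 'a set)"
  shows "card (triples s) + 2 * (q + 1) = (q + 1) * q + 2 * nroots s"
proof -
  have "card {(i, j). i \<noteq> j \<and> pol s i i j = 0} + nroots s = q + 1"
    using card_diagonal_pairs[of UNIV "\<lambda>i j k. pol s i j k = 0"] ex1_pol_root[of s] assms
    by (simp add: card_points imaginary_def nroots_def)
  moreover have "card (triples s) + 2 * card {(i, j). i \<noteq> j \<and> pol s i i j = 0} = (q + 1) * q"
    unfolding q_def using assms by (intro card_triples_of_no_secant) (simp add: imaginary_def)
  ultimately show ?thesis by (rule double_count_arith)
qed

text \<open>At the point of tangency a every j solves \<open>pol s a a j = 0\<close>, while each of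
  the q other points has one solution. This gives 2q + 1 pairs instead of q + 1.\<close>

lemma card_triples_tangent:
  fixes s :: "'a::{finite,field} syndrome"
  assumes s: "s \<in> tangent"
  defines "q \<equiv> card (UNIV :: 'a set)"
  shows "card (triples s) + 2 * (2 * q + 1) = (q + 1) * q + 2 * nroots s"
proof -
  obtain a where a: "apolar s a a" and nl: "s \<notin> low" using s by (auto simp: tangent_def)
  have unique: "i = a \<and> j = a" if "apolar s i j" for i j
    using apolar_unique[OF nl a that] by auto
  let ?E = "{(i, j). i \<noteq> j \<and> pol s i i j = 0}"
  let ?R = "- {a}"
  have "card {(i, j). i \<in> ?R \<and> pol s i i j = 0} = card ?R"
  proof (rule card_eq_of_ex1)
    fix i assume "i \<in> ?R"
    then show "\<exists>!j. pol s i i j = 0" using unique by (intro ex1_pol_root) auto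
  qed simp
  also have "\<dots> = q" by (simp add: Compl_eq_Diff_UNIV card_points q_def)
  finally have R: "card {(i, j). i \<in> ?R \<and> pol s i i j = 0} = q" .
  have "card ({(i, j). i \<in> ?R \<and> pol s i i j = 0} \<union> Pair a ` UNIV) = q + card (Pair a ` (UNIV :: 'a option set))"
    unfolding R[symmetric] by (intro card_Un_disjoint) auto
  also have "{(i, j). i \<in> ?R \<and> pol s i i j = 0} \<union> Pair a ` UNIV = ?E \<union> (\<lambda>i. (i, i)) ` {i. pol s i i i = 0}"
    using a by (auto simp: apolar_def)
  also have "card \<dots> = card ?E + card ((\<lambda>i. (i, i)) ` {i. pol s i i i = 0})"
    by (intro card_Un_disjoint) auto
  finally have "card ?E + nroots s = 2 * q + 1"
    by (simp add: card_image inj_on_def nroots_def card_points q_def)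
  moreover have "card (triples s) + 2 * card ?E = (q + 1) * q"
    unfolding q_def using unique by (intro card_triples_of_no_secant) auto
  ultimately show ?thesis by (rule double_count_arith)
qed

text \<open>Otherwise \<open>pol s a i\<close> has the two roots b and j, and a, i form a second
  apolar pair.\<close>

lemma secant_third_root:
  fixes s :: "'a::{finite,field} syndrome"
  assumes "s \<notin> low" "apolar s a b" "pol s a i j = 0" "i \<noteq> b"
  shows "j = b"
proof (rule ccontr)
  assume "j \<noteq> b"
  moreover have "pol s a i b = 0" using assms(2) pol_sym_eq_0(2)[of s a i b] by (simp add: apolar_def)
  ultimately have "apolar s a i" using assms(3) by (intro apolarI)
  with apolar_unique[OF assms(1,2), of a i] assms(4) show False by (auto simp: doubleton_eq_iff)
qed

text \<open>The end points a, b of the chord occur in no triple, and the third point of a pair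
  avoiding them avoids them too. The count therefore takes place on the q - 1 remaining
  points.\<close>

lemma card_triples_secant:
  fixes s :: "'a::{finite,field} syndrome"
  assumes q5: "card (UNIV :: 'a set) \<ge> 5" and s: "s \<in> secant"
  defines "q \<equiv> card (UNIV :: 'a set)"
  shows "card (triples s) + 2 * (q - 1) = (q - 1) * (q - 2) + 2 * nroots s"
proof -
  obtain a b where ab: "a \<noteq> b" "apolar s a b" and nl: "s \<notin> low" using s secant_iff[OF q5] by blast
  have ba: "apolar s b a" using ab(2) apolar_commute by blast
  note third = secant_third_root[OF nl ab(2)] secant_third_root[OF nl ba]
  let ?R = "- {a, b}"
  have n: "card ?R = q - 1" using ab(1) by (simp add: Compl_eq_Diff_UNIV card_Diff_subset card_points q_def)
  have nap: "\<not> apolar s i j" if "i \<in> ?R" for i j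
    using apolar_unique[OF nl ab(2), of i j] that by auto
  have ex1: "\<exists>!k. k \<in> ?R \<and> pol s i j k = 0" if ij: "i \<in> ?R" "j \<in> ?R" for i j
  proof -
    have "k \<in> ?R" if k: "pol s i j k = 0" for k
    proof -
      have "pol s k i j = 0" using k pol_sym_eq_0[of s] by blast
      with third[of i j] ij show ?thesis by auto
    qed
    with ex1_pol_root[OF nap[OF ij(1), of j]] show ?thesis by blast
  qed
  have "triples s = {(i, j, k). i \<in> ?R \<and> j \<in> ?R \<and> k \<in> ?R \<and> distinct [i, j, k] \<and> pol s i j k = 0}" (is "_ = ?T")
  proof (rule set_eqI)
    fix p :: "'a option \<times> 'a option \<times> 'a option"
    obtain i j k where p: "p = (i, j, k)" by (cases p)
    have "i \<in> ?R \<and> j \<in> ?R \<and> k \<in> ?R" if t: "(i, j, k) \<in> triples s"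
    proof -
      have *: "u \<in> ?R" if "pol s u v w = 0" "\<not> apolar s u v" "\<not> apolar s u w" for u v w
        using third[of v w] that ab(2) ba by auto
      have "pol s i j k = 0" "pol s j i k = 0" "pol s k i j = 0"
        using t pol_sym_eq_0[of s] by (auto simp: triples_def)
      with t show ?thesis
        using *[of i j k] *[of j i k] *[of k i j] apolar_commute[of s] unfolding triples_def by blast
    qed
    moreover have "(i, j, k) \<in> triples s" if "(i, j, k) \<in> ?T" using that nap by (auto simp: triples_def)
    moreover have "distinct [i, j, k] \<and> pol s i j k = 0" if "(i, j, k) \<in> triples s" using that by (auto simp: triples_def)
    ultimately show "p \<in> triples s \<longleftrightarrow> p \<in> ?T" unfolding p by blast
  qed
  then have T: "card (triples s) + 2 * card {(i, j). i \<in> ?R \<and> j \<in> ?R \<and> i \<noteq> j \<and> pol s i i j = 0} = (q - 1) * (q - 1 - 1)"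
    using card_distinct_triples[of ?R "\<lambda>i j k. pol s i j k = 0"] pol_sym_eq_0[of s] ex1 n by simp
  have E: "card {(i, j). i \<in> ?R \<and> j \<in> ?R \<and> i \<noteq> j \<and> pol s i i j = 0} + card {i \<in> ?R. pol s i i i = 0} = q - 1"
    unfolding n[symmetric] using ex1 by (intro card_diagonal_pairs) auto
  \<comment> \<open>The cubic form is nonzero at both end points, so restricting to
    \<open>?R\<close> loses no root.\<close>
  have "pol s a a a \<noteq> 0" "pol s b b b \<noteq> 0" using third[of a a] third[of b b] ab(1) by auto
  then have "{i \<in> ?R. pol s i i i = 0} = {i. pol s i i i = 0}" by auto
  with T E show ?thesis by (simp add: nroots_def numeral_2_eq_2)
qed

section \<open>Roots of the cubic form\<close>

text \<open>The linear form vanishing at j, expanded in those vanishing at a and b, without dividing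
  by \<open>br a b\<close>.\<close>

lemma pol_basis: "br a b * pol s j k l = br j b * pol s a k l + br a j * pol s b k l"
  by (cases s) (simp add: br_def algebra_simps)

text \<open>The binomial expansion obtained by applying \<open>pol_basis\<close> in all three
  arguments.\<close>

lemma pol_cube_basis:
  "br a b ^ 3 * pol s j j j = br j b ^ 3 * pol s a a a + 3 * br j b ^ 2 * br a j * pol s a a b
    + 3 * br j b * br a j ^ 2 * pol s a b b + br a j ^ 3 * pol s b b b"
proof -
  have c: "pol s b a a = pol s a a b" "pol s b a b = pol s a b b" "pol s a b a = pol s a a b" "pol s b b a = pol s a b b"
    using pol_commute[of s] by metis+
  have "br a b * pol s a a j = br j b * pol s a a a + br a j * pol s a a b"
    using pol_basis[of a b s j a a] c pol_commute[of s] by metis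
  moreover have "br a b * pol s a b j = br j b * pol s a a b + br a j * pol s a b b"
    using pol_basis[of a b s j a b] c pol_commute[of s] by metis
  moreover have "br a b * pol s b b j = br j b * pol s a b b + br a j * pol s b b b"
    using pol_basis[of a b s j b b] c pol_commute[of s] by metis
  moreover have "br a b * pol s a j j = br j b * pol s a a j + br a j * pol s a b j"
    using pol_basis[of a b s j a j] pol_commute[of s] by metis
  moreover have "br a b * pol s b j j = br j b * pol s a b j + br a j * pol s b b j"
    using pol_basis[of a b s j b j] pol_commute[of s] by metis
  moreover note pol_basis[of a b s j j j]
  ultimately show ?thesis by algebra
qed

text \<open>\<open>br j b\<close> and \<open>br a j\<close> are homogeneous coordinates of j
  relative to a and b, so this is \<open>ex1_projective_root\<close> after a change of
  basis.\<close>

lemma ex1_br_root: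
  assumes "a \<noteq> b" "A \<noteq> 0 \<or> B \<noteq> 0"
  shows "\<exists>!j. A * br j b + B * br a j = 0"
proof -
  let ?u = "A * hy b - B * hy a" and ?v = "B * hx a - A * hx b"
  have e: "A * br j b + B * br a j = ?u * hx j + ?v * hy j" for j
    by (simp add: br_def algebra_simps)
  have "?u \<noteq> 0 \<or> ?v \<noteq> 0"
  proof (rule ccontr)
    assume "\<not> (?u \<noteq> 0 \<or> ?v \<noteq> 0)"
    then have "A * br j b + B * br a j = 0" for j unfolding e by simp
    from this[of a] this[of b] assms show False by simp
  qed
  from ex1_projective_root[OF this] show ?thesis unfolding e .
qed

text \<open>In a basis containing the point of tangency a, the cubic form is
  \<open>br a j ^ 2\<close> times a linear form. Its root c differs from a because the coefficient
  \<open>3 * pol s a b b\<close> is nonzero.\<close>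

lemma nroots_tangent:
  fixes s :: "'a::{finite,field} syndrome"
  assumes s: "s \<in> tangent" and three: "(3::'a) \<noteq> 0"
  shows "nroots s = 2"
proof -
  obtain a where a: "apolar s a a" and nl: "s \<notin> low" using s by (auto simp: tangent_def)
  obtain b where b: "b \<noteq> a" by (metis option.distinct(1))
  have nz: "pol s a b b \<noteq> 0"
  proof
    assume "pol s a b b = 0"
    moreover have "pol s a b a = 0" using a pol_sym_eq_0(2)[of s a b a] by (simp add: apolar_def)
    ultimately have "apolar s a b" using b by (intro apolarI[of s a b b a])
    with apolar_unique[OF nl a, of a b] b show False by auto
  qed
  obtain c where c: "3 * pol s a b b * br c b + pol s b b b * br a c = 0"
    and cu: "\<And>j. 3 * pol s a b b * br j b + pol s b b b * br a j = 0 \<Longrightarrow> j = c"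
    using ex1_br_root[of a b "3 * pol s a b b" "pol s b b b"] b nz three by auto
  have "c \<noteq> a" using c nz three b by auto
  have "pol s j j j = 0 \<longleftrightarrow> j = a \<or> j = c" for j
  proof -
    have "br a b ^ 3 * pol s j j j = br a j ^ 2 * (3 * pol s a b b * br j b + pol s b b b * br a j)"
      unfolding pol_cube_basis[of a b s j] using a by (simp add: apolar_def power2_eq_square power3_eq_cube algebra_simps)
    moreover have "br a b ^ 3 \<noteq> 0" using b by simp
    ultimately have "pol s j j j = 0 \<longleftrightarrow> br a j ^ 2 = 0 \<or> 3 * pol s a b b * br j b + pol s b b b * br a j = 0"
      by (metis mult_eq_0_iff)
    moreover have "3 * pol s a b b * br j b + pol s b b b * br a j = 0 \<longleftrightarrow> j = c"
    proof
      assume "j = c"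
      show "3 * pol s a b b * br j b + pol s b b b * br a j = 0" unfolding \<open>j = c\<close> by (rule c)
    qed (rule cu)
    ultimately show ?thesis by (simp add: eq_commute[of a j])
  qed
  then have "{j. pol s j j j = 0} = {a, c}" by (simp only: set_eq_iff mem_Collect_eq insert_iff empty_iff simp_thms)
  then show ?thesis using \<open>c \<noteq> a\<close> by (simp add: nroots_def)
qed

text \<open>Exactly two roots a, b cannot occur. After removing both factors a linear factor
  remains, and its root could be a or b only if \<open>apolar s a a\<close> or
  \<open>apolar s b b\<close>.\<close>

lemma nroots_not_tangent:
  fixes s :: "'a::{finite,field} syndrome"
  assumes nt: "\<And>a. \<not> apolar s a a" and three: "(3::'a) \<noteq> 0"
  shows "nroots s \<in> {0, 1, 3}"
proof (cases "\<exists>a b. a \<noteq> b \<and> pol s a a a = 0 \<and> pol s b b b = 0")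
  case True
  then obtain a b where ab: "a \<noteq> b" "pol s a a a = 0" "pol s b b b = 0" by blast
  have A: "pol s a a b \<noteq> 0" using apolarI[of s a a a b] ab nt by blast
  have B: "pol s a b b \<noteq> 0" using apolarI[of s b b b a] ab nt pol_sym_eq_0[of s] by blast
  obtain c where c: "pol s a a b * br c b + pol s a b b * br a c = 0"
    and cu: "\<And>j. pol s a a b * br j b + pol s a b b * br a j = 0 \<Longrightarrow> j = c"
    using ex1_br_root[of a b "pol s a a b" "pol s a b b"] ab A by auto
  have "c \<noteq> a" "c \<noteq> b" using c A B ab by auto
  have "pol s j j j = 0 \<longleftrightarrow> j = a \<or> j = b \<or> j = c" for j
  proof -
    have "br a b ^ 3 * pol s j j j = 3 * br j b * br a j * (pol s a a b * br j b + pol s a b b * br a j)"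
      unfolding pol_cube_basis[of a b s j] using ab by (simp add: power2_eq_square algebra_simps)
    moreover have "br a b \<noteq> 0" using ab by simp
    ultimately have "pol s j j j = 0 \<longleftrightarrow> br j b = 0 \<or> br a j = 0 \<or> pol s a a b * br j b + pol s a b b * br a j = 0"
      using three by (metis mult_eq_0_iff power_not_zero)
    then show ?thesis using c cu[of j] unfolding br_eq_0_iff by blast
  qed
  then have "{j. pol s j j j = 0} = {a, b, c}" by blast
  then show ?thesis using \<open>c \<noteq> a\<close> \<open>c \<noteq> b\<close> \<open>a \<noteq> b\<close> by (simp add: nroots_def)
next
  case False
  then have "nroots s \<le> Suc 0"
    unfolding nroots_def by (intro card_le_Suc0_iff_eq[THEN iffD2, OF finite]) blast
  then show ?thesis by auto
qed

text \<open>Apolarity of a and b kills the mixed terms of the expansion, leaving a diagonal cubic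
  form.\<close>

lemma secant_cube_form:
  fixes s :: "'a::{finite,field} syndrome"
  assumes q: "card (UNIV :: 'a set) \<ge> 5" and s: "s \<in> secant"
  obtains a b where "a \<noteq> b" "pol s a a a \<noteq> 0" "pol s b b b \<noteq> 0"
    "\<forall>j. pol s j j j = 0 \<longleftrightarrow> br j b ^ 3 * pol s a a a + br a j ^ 3 * pol s b b b = 0"
proof -
  obtain a b where ab: "a \<noteq> b" "apolar s a b" and nl: "s \<notin> low" using s secant_iff[OF q] by blast
  have ba: "apolar s b a" using ab(2) apolar_commute by blast
  have z: "pol s a a b = 0" "pol s a b b = 0"
    using ab(2) pol_sym_eq_0(2)[of s a a b] by (simp_all add: apolar_def)
  show thesis
  proof (rule that[OF ab(1)])
    show "pol s a a a \<noteq> 0" "pol s b b b \<noteq> 0"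
      using secant_third_root[OF nl ab(2), of a a] secant_third_root[OF nl ba, of b b] ab(1) by auto
    have "br a b ^ 3 * pol s j j j = br j b ^ 3 * pol s a a a + br a j ^ 3 * pol s b b b" for j
      unfolding pol_cube_basis[of a b s j] z by simp
    moreover have "br a b ^ 3 \<noteq> 0" using ab(1) by simp
    ultimately show "\<forall>j. pol s j j j = 0 \<longleftrightarrow> br j b ^ 3 * pol s a a a + br a j ^ 3 * pol s b b b = 0"
      by (metis mult_eq_0_iff)
  qed
qed

text \<open>Both diagonal coefficients are cubes, so the equation compares two cubes and reduces to
  a linear one.\<close>

lemma nroots_secant_of_bij_cube:
  fixes s :: "'a::{finite,field} syndrome"
  assumes q: "card (UNIV :: 'a set) \<ge> 5" and s: "s \<in> secant" and cube: "inj (\<lambda>x::'a. x ^ 3)"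
  shows "nroots s = 1"
proof -
  obtain a b where ab: "a \<noteq> b" "pol s a a a \<noteq> 0" "pol s b b b \<noteq> 0"
    and "\<forall>j. pol s j j j = 0 \<longleftrightarrow> br j b ^ 3 * pol s a a a + br a j ^ 3 * pol s b b b = 0"
    using secant_cube_form[OF q s] .
  then have f: "pol s j j j = 0 \<longleftrightarrow> br j b ^ 3 * pol s a a a + br a j ^ 3 * pol s b b b = 0" for j by blast
  have "surj (\<lambda>x::'a. x ^ 3)" using cube by (simp add: finite_UNIV_inj_surj)
  then obtain A B where A: "pol s a a a = A ^ 3" and B: "pol s b b b = B ^ 3" by (metis surjD)
  have "pol s j j j = 0 \<longleftrightarrow> A * br j b + B * br a j = 0" for j
  proof -
    have "pol s j j j = 0 \<longleftrightarrow> (A * br j b) ^ 3 = (- (B * br a j)) ^ 3"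
      unfolding f A B by (simp add: power_mult_distrib eq_neg_iff_add_eq_0 mult.commute)
    also have "\<dots> \<longleftrightarrow> A * br j b = - (B * br a j)" by (rule inj_eq[OF cube])
    finally show ?thesis by (simp add: eq_neg_iff_add_eq_0)
  qed
  moreover have "\<exists>!j. A * br j b + B * br a j = 0" using ab A by (intro ex1_br_root) auto
  then obtain c where "A * br c b + B * br a c = 0" "\<And>j. A * br j b + B * br a j = 0 \<Longrightarrow> j = c" by auto
  ultimately have "{j. pol s j j j = 0} = {c}" by blast
  then show ?thesis by (simp add: nroots_def)
qed

text \<open>Scaling one coordinate relative to a and b by \<omega> permutes the roots. A single root
  would be fixed, hence equal to a or b, but these are not roots.\<close>

lemma nroots_secant_of_cube_root_of_unity:
  fixes s :: "'a::{finite,field} syndrome"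
  assumes q: "card (UNIV :: 'a set) \<ge> 5" and s: "s \<in> secant" and w: "(\<omega>::'a) ^ 3 = 1" "\<omega> \<noteq> 1"
  shows "nroots s \<noteq> 1"
proof
  obtain a b where ab: "a \<noteq> b" "pol s a a a \<noteq> 0" "pol s b b b \<noteq> 0"
    and "\<forall>j. pol s j j j = 0 \<longleftrightarrow> br j b ^ 3 * pol s a a a + br a j ^ 3 * pol s b b b = 0"
    using secant_cube_form[OF q s] .
  then have f: "pol s j j j = 0 \<longleftrightarrow> br j b ^ 3 * pol s a a a + br a j ^ 3 * pol s b b b = 0" for j by blast
  assume "nroots s = 1"
  then obtain j where j: "{j. pol s j j j = 0} = {j}" by (auto simp: nroots_def card_1_singleton_iff)
  then have rj: "br j b ^ 3 * pol s a a a + br a j ^ 3 * pol s b b b = 0" using f[of j] by auto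
  have "j \<noteq> a" "j \<noteq> b" using rj ab by auto
  \<comment> \<open>k is the image of j: its coordinate ratio relative to a and b is \<omega> times
    that of j.\<close>
  obtain k where k: "br a j * br k b + (- (\<omega> * br j b)) * br a k = 0"
    using ex1_br_root[OF ab(1), of "br a j" "- (\<omega> * br j b)"] \<open>j \<noteq> a\<close> by auto
  then have kk: "br a j * br k b = \<omega> * br j b * br a k" by simp
  have "br a j ^ 3 * (br k b ^ 3 * pol s a a a + br a k ^ 3 * pol s b b b) =
      (br a j * br k b) ^ 3 * pol s a a a + br a j ^ 3 * br a k ^ 3 * pol s b b b"
    by (simp add: power_mult_distrib algebra_simps)
  also have "\<dots> = br a k ^ 3 * (br j b ^ 3 * pol s a a a + br a j ^ 3 * pol s b b b)"
    unfolding kk by (simp add: power_mult_distrib w algebra_simps)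
  finally have "pol s k k k = 0" unfolding f rj using \<open>j \<noteq> a\<close> by simp
  with j have "k = j" by auto
  with kk w(2) \<open>j \<noteq> a\<close> \<open>j \<noteq> b\<close> show False by auto
qed

section \<open>Root counts on the cubic and in characteristic 3\<close>

lemma nroots_low:
  fixes s :: "'a::{finite,field} syndrome"
  assumes "s \<in> low" "s \<noteq> 0"
  shows "nroots s = 1"
proof -
  obtain a c where s: "s = syn (single a c)" using assms(1) low_iff by blast
  have "c \<noteq> 0" using assms(2) by (auto simp: s single_def syn_zero)
  then have "{j. pol s j j j = 0} = {a}" by (auto simp: s pol_syn_single)
  then show ?thesis by (simp add: nroots_def)
qed

lemma nroots_zero: "nroots (0 :: 'a::{finite,field} syndrome) = card (UNIV :: 'a set) + 1"
  by (simp add: nroots_def card_points)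

text \<open>In characteristic 3 the middle terms vanish, and since every element is a cube the form
  is the cube of a linear form. It has one root unless it is identically zero.\<close>

lemma nroots_char3:
  fixes s0 s1 s2 s3 :: "'a::{finite,field}"
  assumes three: "(3::'a) = 0" and cube: "inj (\<lambda>x::'a. x ^ 3)"
  shows "nroots (s0, s1, s2, s3) = (if s0 = 0 \<and> s3 = 0 then card (UNIV :: 'a set) + 1 else 1)"
proof -
  have p: "pol (s0, s1, s2, s3) j j j = hy j ^ 3 * s0 - hx j ^ 3 * s3" for j
  proof -
    have "pol (s0, s1, s2, s3) j j j = hy j ^ 3 * s0 - hx j ^ 3 * s3 - 3 * (hx j * hy j ^ 2 * s1 - hx j ^ 2 * hy j * s2)"
      by (simp add: power2_eq_square power3_eq_cube algebra_simps)
    then show ?thesis unfolding three by simp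
  qed
  show ?thesis
  proof (cases "s0 = 0 \<and> s3 = 0")
    case True
    then show ?thesis unfolding nroots_def p by (simp add: card_points)
  next
    case False
    have "surj (\<lambda>x::'a. x ^ 3)" using cube by (simp add: finite_UNIV_inj_surj)
    then obtain A B where A: "s3 = A ^ 3" and B: "s0 = B ^ 3" by (metis surjD)
    have "pol (s0, s1, s2, s3) j j j = 0 \<longleftrightarrow> (- A) * hx j + B * hy j = 0" for j
    proof -
      have "pol (s0, s1, s2, s3) j j j = 0 \<longleftrightarrow> (B * hy j) ^ 3 = (A * hx j) ^ 3"
        by (simp only: p) (simp add: A B power_mult_distrib mult.commute)
      also have "\<dots> \<longleftrightarrow> B * hy j = A * hx j" by (rule inj_eq[OF cube])
      finally show ?thesis by (auto simp: algebra_simps)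
    qed
    moreover have "\<exists>!j. (- A) * hx j + B * hy j = 0" using False A B by (intro ex1_projective_root) auto
    then obtain c where "(- A) * hx c + B * hy c = 0" "\<And>j. (- A) * hx j + B * hy j = 0 \<Longrightarrow> j = c" by auto
    ultimately have "{j. pol (s0, s1, s2, s3) j j j = 0} = {c}" by blast
    with False show ?thesis by (simp add: nroots_def del: pol.simps)
  qed
qed

text \<open>In characteristic 3 every tangent meets the line \<open>s0 = s3 = 0\<close>; the linear
  equation for a selects the tangent through the given point of that line.\<close>

lemma tangent_of_char3:
  fixes s1 s2 :: "'a::{finite,field}"
  assumes three: "(3::'a) = 0" and ne: "s1 \<noteq> 0 \<or> s2 \<noteq> 0"
  shows "(0, s1, s2, 0) \<in> tangent"
proof -
  obtain a where a: "s2 * hx a + s1 * hy a = 0" using ex1_projective_root[of s2 s1] ne by auto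
  have "apolar (0, s1, s2, 0) a a"
  proof -
    \<comment> \<open>Modulo 3 both apolarity conditions are multiples of the equation defining
      a.\<close>
    have "- (hx a * hy a + hy a * hx a) * s1 + hx a * hx a * s2 = hx a * (s2 * hx a + s1 * hy a) - 3 * (hx a * hy a * s1)"
      "hy a * hy a * s1 - (hx a * hy a + hy a * hx a) * s2 = hy a * (s2 * hx a + s1 * hy a) - 3 * (hx a * hy a * s2)"
      by (simp_all add: algebra_simps)
    then show ?thesis unfolding apolar_iff a three by simp
  qed
  moreover have "(0, s1, s2, 0) \<notin> low"
  proof
    assume "(0, s1, s2, 0) \<in> low"
    then obtain b c where "(0, s1, s2, 0) = syn (single b c)" using low_iff by blast
    with ne show False by (cases b) (auto simp: syn_single)
  qed
  ultimately show ?thesis by (auto simp: tangent_def)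
qed

section \<open>Cubes in the field\<close>

text \<open>The orbits of f have size 1 or 3; the induction removes one orbit of size 3 at a
  time.\<close>

lemma card_mod_3_eq_card_fixed_points:
  assumes "finite A" and "\<And>x. x \<in> A \<Longrightarrow> f x \<in> A" and "\<And>x. x \<in> A \<Longrightarrow> f (f (f x)) = x"
  shows "card A mod 3 = card {x \<in> A. f x = x} mod 3"
  using assms
proof (induction A rule: finite_psubset_induct)
  case (psubset A)
  show ?case
  proof (cases "\<forall>x\<in>A. f x = x")
    case True
    then have "{x \<in> A. f x = x} = A" by blast
    then show ?thesis by simp
  next
    case False
    then obtain a where a: "a \<in> A" "f a \<noteq> a" by blast
    let ?B = "{a, f a, f (f a)}"
    have B: "?B \<subseteq> A" using a psubset.prems(1) by blast
    have ne: "f (f a) \<noteq> f a" "f (f a) \<noteq> a" using psubset.prems(2)[OF a(1)] a(2) by metis+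
    have cardB: "card ?B = 3" using a(2) ne by simp
    have "card (A - ?B) mod 3 = card {x \<in> A - ?B. f x = x} mod 3"
    proof (rule psubset.IH)
      show "A - ?B \<subset> A" using a by blast
      show "f x \<in> A - ?B" if x: "x \<in> A - ?B" for x
        using x psubset.prems a by auto metis+
      show "f (f (f x)) = x" if "x \<in> A - ?B" for x using that psubset.prems(2) by blast
    qed
    also have "{x \<in> A - ?B. f x = x} = {x \<in> A. f x = x}"
      using a(2) ne psubset.prems(2)[OF a(1)] by auto
    finally have "card (A - ?B) mod 3 = card {x \<in> A. f x = x} mod 3" .
    moreover have "card A = card (A - ?B) + 3"
      using card_Diff_subset[OF _ B] card_mono[OF psubset.hyps B] cardB by simp
    ultimately show ?thesis by simp
  qed
qed

lemma three_eq_0_iff: "(3::'a::{finite,field}) = 0 \<longleftrightarrow> card (UNIV :: 'a set) mod 3 = 0"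
proof
  assume three: "(3::'a) = 0"
  \<comment> \<open>Translation by 1 has order 3 and no fixed points.\<close>
  have "card (UNIV :: 'a set) mod 3 = card {x \<in> (UNIV :: 'a set). x + 1 = x} mod 3"
  proof (rule card_mod_3_eq_card_fixed_points)
    fix x :: 'a
    have "x + 1 + 1 + 1 = x + 3" by simp
    then show "x + 1 + 1 + 1 = x" unfolding three by simp
  qed auto
  then show "card (UNIV :: 'a set) mod 3 = 0" by simp
next
  assume q: "card (UNIV :: 'a set) mod 3 = 0"
  show "(3::'a) = 0"
  proof (rule ccontr)
    assume three: "(3::'a) \<noteq> 0"
    define A where "A = {(a, b, c). a + b + c = (0::'a)}"
    \<comment> \<open>McKay's proof of Cauchy's theorem\<close>
    define rot where "rot = (\<lambda>(a :: 'a, b :: 'a, c :: 'a). (b, c, a))"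
    have "A = (\<lambda>(a, b). (a, b, - a - b)) ` UNIV"
      by (auto simp: A_def image_iff split_paired_Ex eq_neg_iff_add_eq_0 algebra_simps)
    also have "card \<dots> = card (UNIV :: 'a set) ^ 2"
      by (subst card_image) (auto simp: inj_on_def power2_eq_square UNIV_Times_UNIV[symmetric] card_cartesian_product simp del: UNIV_Times_UNIV)
    finally have "card A mod 3 = 0" using q by (simp add: power2_eq_square mod_eq_0_iff_dvd)
    moreover have "card A mod 3 = card {x \<in> A. rot x = x} mod 3"
      by (rule card_mod_3_eq_card_fixed_points)
        (auto simp: A_def rot_def algebra_simps intro: finite_subset[of _ UNIV])
    moreover have "{x \<in> A. rot x = x} = {(0, 0, 0)}"
    proof -
      have zero: "x = (0, 0, 0)" if x: "x \<in> A" "rot x = x" for x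
      proof -
        obtain a b c where abc: "x = (a, b, c)" by (cases x)
        have ca: "b = a" "c = a" using x(2) unfolding rot_def abc prod.case prod.inject by blast+
        have "3 * a = a + b + c" by (simp add: ca)
        also have "\<dots> = 0" using x(1) by (simp add: A_def abc)
        finally show ?thesis using three by (simp add: abc ca)
      qed
      have "{x \<in> A. rot x = x} \<subseteq> {(0, 0, 0)}"
      proof
        fix x assume "x \<in> {x \<in> A. rot x = x}"
        then have "x \<in> A" "rot x = x" by blast+
        then have "x = (0, 0, 0)" by (rule zero)
        then show "x \<in> {(0, 0, 0)}" by simp
      qed
      moreover have "(0, 0, 0) \<in> A" "rot (0, 0, 0) = (0, 0, 0)" by (simp_all add: A_def rot_def)
      ultimately show ?thesis by (intro equalityI) simp_all
    qed
    ultimately show False by simp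
  qed
qed

text \<open>Multiplication by \<omega> acts on the nonzero elements with all orbits of size
  3.\<close>

lemma card_mod_3_of_cube_root_of_unity:
  assumes w: "(\<omega>::'a::{finite,field}) ^ 3 = 1" "\<omega> \<noteq> 1"
  shows "card (UNIV :: 'a set) mod 3 = 1"
proof -
  have w0: "\<omega> \<noteq> 0" using w by auto
  have "card (UNIV - {0::'a}) mod 3 = card {x \<in> UNIV - {0::'a}. \<omega> * x = x} mod 3"
  proof (rule card_mod_3_eq_card_fixed_points)
    fix x
    have "\<omega> * (\<omega> * (\<omega> * x)) = \<omega> ^ 3 * x" by (simp add: power3_eq_cube)
    then show "\<omega> * (\<omega> * (\<omega> * x)) = x" by (simp add: w)
  qed (use w0 in auto)
  moreover have "{x \<in> UNIV - {0::'a}. \<omega> * x = x} = {}" using w by auto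
  ultimately have "card (UNIV - {0::'a}) mod 3 = 0" by (simp only: card.empty mod_0)
  then have "(card (UNIV :: 'a set) - 1) mod 3 = 0" by simp
  moreover have "card (UNIV :: 'a set) \<ge> 1" by (simp add: Suc_le_eq card_gt_0_iff)
  ultimately show ?thesis by presburger
qed

lemma inj_cube:
  assumes q: "card (UNIV :: 'a::{finite,field} set) mod 3 \<noteq> 1"
  shows "inj (\<lambda>x::'a. x ^ 3)"
proof (rule injI, rule ccontr)
  fix x y :: 'a assume xy: "x ^ 3 = y ^ 3" "x \<noteq> y"
  then have "y \<noteq> 0" by auto
  with xy have "(x / y) ^ 3 = 1" "x / y \<noteq> 1" by (auto simp: power_divide)
  with q show False using card_mod_3_of_cube_root_of_unity by blast
qed

lemma ex_cube_root_of_unity: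
  assumes q: "card (UNIV :: 'a::{finite,field} set) mod 3 = 1"
  shows "\<exists>\<omega>::'a. \<omega> ^ 3 = 1 \<and> \<omega> \<noteq> 1"
proof -
  let ?A = "UNIV - {0, 1::'a}"
  \<comment> \<open>a map of order 3 whose fixed points are the primitive sixth roots of unity\<close>
  let ?f = "\<lambda>x::'a. 1 / (1 - x)"
  have "card ?A = card (UNIV :: 'a set) - 2" by (simp add: card_Diff_subset)
  moreover have "card {0, 1::'a} \<le> card (UNIV :: 'a set)" by (rule card_mono) auto
  moreover have "(n - 2) mod 3 = 2" if "2 \<le> n" "n mod 3 = 1" for n :: nat
  proof -
    have n: "n = 3 * (n div 3) + 1" using that(2) by (metis mult_div_mod_eq)
    with that(1) have "n div 3 \<noteq> 0" by auto
    then obtain k where "n div 3 = Suc k" using not0_implies_Suc by blast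
    moreover note n
    ultimately have "n - 2 = 2 + 3 * k" by simp
    then show ?thesis by (simp only: mod_mult_self2) simp
  qed
  ultimately have "card ?A mod 3 = 2" using q by simp
  moreover have "card ?A mod 3 = card {x \<in> ?A. ?f x = x} mod 3"
  proof (rule card_mod_3_eq_card_fixed_points)
    fix x assume "x \<in> ?A"
    then have x: "x \<noteq> 0" "1 - x \<noteq> 0" by auto
    show "?f x \<in> ?A" using x by (simp add: divide_eq_eq)
    have "1 - ?f x = - x / (1 - x)" using x(2) by (simp add: diff_divide_eq_iff)
    then have "?f (?f x) = (1 - x) / (- x)" by simp
    moreover have "1 - (1 - x) / (- x) = 1 / x" using x(1) by (simp add: field_simps)
    ultimately show "?f (?f (?f x)) = x" by simp
  qed simp
  ultimately have "card {x \<in> ?A. ?f x = x} mod 3 = 2" by (simp only:)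
  then have "card {x \<in> ?A. ?f x = x} \<noteq> 0" by (metis mod_0 zero_neq_numeral)
  then have "{x \<in> ?A. ?f x = x} \<noteq> {}" by (intro notI) (simp only: card.empty)
  then obtain x where "x \<in> ?A" "?f x = x" by blast
  then have x: "x \<noteq> 1" "1 / (1 - x) = x" by blast+
  then have x1: "x * (1 - x) = 1" by (simp add: field_simps)
  \<comment> \<open>The polynomial x^2 - x + 1 divides x^3 + 1.\<close>
  then have "(- x) ^ 3 = 1" by algebra
  moreover have "- x \<noteq> 1"
  proof
    assume "- x = 1"
    then have "x = - 1" by (simp add: equation_minus_iff)
    then have "(3::'a) = 1 - x * (1 - x)" by simp
    then have "(3::'a) = 0" by (simp add: x1)
    with q three_eq_0_iff[where 'a = 'a] show False by simp
  qed
  ultimately show ?thesis by blast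
qed

section \<open>Sizes of the classes and moments of the root count\<close>

lemma card_supp_eq:
  fixes J :: "'i::finite set"
  shows "card {x :: 'i \<Rightarrow> 'a::{finite,zero}. supp x = J} = (card (UNIV :: 'a set) - 1) ^ card J"
proof (induction J rule: finite_induct[OF finite])
  case 1
  have "{x :: 'i \<Rightarrow> 'a. supp x = {}} = {\<lambda>_. 0}" by (auto simp: supp_def)
  then show ?case by simp
next
  case (2 j J)
  let ?g = "\<lambda>(x :: 'i \<Rightarrow> 'a, c). x(j := c)"
  have "bij_betw ?g ({x. supp x = J} \<times> (UNIV - {0})) {x. supp x = insert j J}"
    by (rule bij_betw_byWitness[where f' = "\<lambda>x. (x(j := 0), x j)"])
      (use 2(2) in \<open>auto simp: supp_def fun_eq_iff split: if_splits\<close>)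
  from bij_betw_same_card[OF this] show ?case
    using 2 by (simp add: card_cartesian_product mult.commute)
qed

lemma card_hweight_eq:
  "card {x :: 'i::finite \<Rightarrow> 'a::{finite,zero}. hweight x = w} =
    (card (UNIV :: 'i set) choose w) * (card (UNIV :: 'a set) - 1) ^ w"
proof -
  have "{x :: 'i \<Rightarrow> 'a. hweight x = w} = (\<Union>J \<in> {J. J \<subseteq> UNIV \<and> card J = w}. {x. supp x = J})"
    by (auto simp: hweight_supp)
  also have "card \<dots> = (\<Sum>J | J \<subseteq> (UNIV :: 'i set) \<and> card J = w. card {x :: 'i \<Rightarrow> 'a. supp x = J})"
    by (rule card_UN_disjoint) auto
  also have "\<dots> = (\<Sum>J | J \<subseteq> (UNIV :: 'i set) \<and> card J = w. (card (UNIV :: 'a set) - 1) ^ w)"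
    by (rule sum.cong) (auto simp: card_supp_eq)
  finally show ?thesis by (simp add: n_subsets[of "UNIV :: 'i set", simplified])
qed

lemma card_low:
  assumes q: "card (UNIV :: 'a::{finite,field} set) \<ge> 5"
  shows "card (low :: 'a syndrome set) = card (UNIV :: 'a set) ^ 2"
proof -
  let ?X = "{x :: 'a option \<Rightarrow> 'a. hweight x = 0} \<union> {x. hweight x = 1}"
  have "(low :: 'a syndrome set) = syn ` ?X"
  proof -
    have "?X = {x. hweight x \<le> 1}" by auto
    then show ?thesis unfolding low_def by blast
  qed
  moreover have "inj_on syn ?X"
    by (rule inj_onI, rule syn_eq_imp_eq_hweight[OF q]) auto
  ultimately have "card (low :: 'a syndrome set) = card ?X" by (metis card_image)
  also have "\<dots> = card {x :: 'a option \<Rightarrow> 'a. hweight x = 0} + card {x :: 'a option \<Rightarrow> 'a. hweight x = 1}"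
    by (rule card_Un_disjoint) auto
  also have "\<dots> = 1 + (card (UNIV :: 'a set) + 1) * (card (UNIV :: 'a set) - 1)"
    unfolding card_hweight_eq by (simp add: card_points)
  also have "\<dots> = card (UNIV :: 'a set) ^ 2"
    using q by (cases "card (UNIV :: 'a set)") (auto simp: power2_eq_square)
  finally show ?thesis .
qed

text \<open>By the minimum distance, vectors of weight 2 with equal syndrome coincide, so it
  suffices to count these vectors.\<close>

lemma card_secant:
  assumes q: "card (UNIV :: 'a::{finite,field} set) \<ge> 5"
  shows "2 * card (secant :: 'a syndrome set) =
    (card (UNIV :: 'a set) + 1) * card (UNIV :: 'a set) * (card (UNIV :: 'a set) - 1) ^ 2"
proof -
  let ?q = "card (UNIV :: 'a set)"
  have "(secant :: 'a syndrome set) = syn ` {x. hweight x = 2}" unfolding secant_def by blast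
  moreover have "inj_on syn {x :: 'a option \<Rightarrow> 'a. hweight x = 2}"
    by (rule inj_onI, rule syn_eq_imp_eq_hweight[OF q]) auto
  ultimately have "card (secant :: 'a syndrome set) = card {x :: 'a option \<Rightarrow> 'a. hweight x = 2}"
    by (metis card_image)
  also have "\<dots> = ((?q + 1) choose 2) * (?q - 1) ^ 2" unfolding card_hweight_eq card_points ..
  finally have "2 * card (secant :: 'a syndrome set) = 2 * ((?q + 1) choose 2) * (?q - 1) ^ 2" by simp
  also have "2 * ((?q + 1) choose 2) = (?q + 1) * ?q" by (simp add: choose_two)
  finally show ?thesis .
qed

lemma card_syndrome_graph:
  fixes P :: "'a::finite syndrome \<Rightarrow> bool"
  assumes "\<And>u v w x. P (u, v, w, x) \<longleftrightarrow> w = f u v \<and> x = g u v"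
  shows "card {s. P s} = card (UNIV :: 'a set) ^ 2"
proof -
  have "{s. P s} = (\<lambda>(u, v). (u, v, f u v, g u v)) ` UNIV"
    by (auto simp: assms image_iff split_paired_Ex)
  moreover have "inj (\<lambda>(u, v). (u, v, f u v, g u v))" by (auto simp: inj_on_def)
  ultimately have "card {s. P s} = card (UNIV :: ('a \<times> 'a) set)" by (simp only: card_image)
  then show ?thesis
    by (simp add: UNIV_Times_UNIV[symmetric] card_cartesian_product power2_eq_square del: UNIV_Times_UNIV)
qed

lemma card_apolar_diagonal: "card {s :: 'a::{finite,field} syndrome. apolar s a a} = card (UNIV :: 'a set) ^ 2"
proof -
  have sq: "card (UNIV :: ('a \<times> 'a) set) = card (UNIV :: 'a set) ^ 2"
    by (simp add: UNIV_Times_UNIV[symmetric] card_cartesian_product power2_eq_square del: UNIV_Times_UNIV)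
  show ?thesis
  proof (cases a)
    case None
    have "{s :: 'a syndrome. apolar s a a} = (\<lambda>(u, v). (0, 0, u, v)) ` UNIV"
      by (auto simp: None apolar_iff image_iff split_paired_Ex)
    moreover have "inj (\<lambda>(u, v). (0::'a, 0::'a, u::'a, v::'a))" by (auto simp: inj_on_def)
    ultimately show ?thesis by (simp only: card_image sq)
  next
    case (Some t)
    \<comment> \<open>At a finite point apolarity is the linear recurrence with double
      characteristic root t, so the first two coordinates are free.\<close>
    let ?z = "\<lambda>u v. 2 * t * v - t * t * u"
    have "apolar (u, v, w, x) a a \<longleftrightarrow> w = ?z u v \<and> x = ?z v w" for u v w x
      unfolding apolar_iff Some by (auto simp: algebra_simps)
    then show ?thesis by (intro card_syndrome_graph[of _ ?z "\<lambda>u v. ?z v (?z u v)"]) auto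
  qed
qed

text \<open>Each of the q + 1 tangents contributes q^2 syndromes less the q multiples of its column.
  Uniqueness of the apolar pair makes these pieces disjoint.\<close>

lemma card_tangent:
  "card (tangent :: 'a::{finite,field} syndrome set) =
    (card (UNIV :: 'a set) + 1) * (card (UNIV :: 'a set) ^ 2 - card (UNIV :: 'a set))"
proof -
  let ?q = "card (UNIV :: 'a set)"
  let ?D = "\<lambda>a. {s :: 'a syndrome. apolar s a a} - range (\<lambda>c. syn (single a c))"
  have "s \<in> low \<and> apolar s a a \<longleftrightarrow> s \<in> range (\<lambda>c. syn (single a c))" for s :: "'a syndrome" and a
  proof
    assume l: "s \<in> low \<and> apolar s a a"
    then obtain b c where s: "s = syn (single b c)" using low_iff by blast
    have "c = 0 \<or> b = a"
    proof (rule ccontr)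
      assume n: "\<not> (c = 0 \<or> b = a)"
      have "pol s a a a = 0" using l by (simp add: apolar_def)
      with n show False by (simp add: s pol_syn_single)
    qed
    then have "s = syn (single a c)" using s by (auto simp: single_def)
    then show "s \<in> range (\<lambda>c. syn (single a c))" by blast
  next
    assume "s \<in> range (\<lambda>c. syn (single a c))"
    then show "s \<in> low \<and> apolar s a a" by (auto simp: apolar_def pol_syn_single intro: lowI)
  qed
  then have "tangent = (\<Union>a. ?D a)" unfolding tangent_def by blast
  moreover have "card (\<Union>a. ?D a) = (\<Sum>a\<in>UNIV. card (?D a))"
  proof (rule card_UN_disjoint)
    show "\<forall>a\<in>UNIV. \<forall>b\<in>UNIV. a \<noteq> b \<longrightarrow> ?D a \<inter> ?D b = {}"
    proof (intro ballI impI)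
      fix a b :: "'a option" assume "a \<noteq> b"
      have False if s: "s \<in> ?D a" "s \<in> ?D b" for s
      proof -
        have "s \<notin> low" using s \<open>\<And>s a. (s \<in> low \<and> apolar s a a) = (s \<in> range (\<lambda>c. syn (single a c)))\<close> by blast
        with apolar_unique[of s a a b b] s \<open>a \<noteq> b\<close> show False by auto
      qed
      then show "?D a \<inter> ?D b = {}" by blast
    qed
  qed auto
  moreover have "card (?D a) = ?q ^ 2 - ?q" for a
  proof -
    have "inj (\<lambda>c. syn (single a c))" by (cases a) (auto simp: inj_on_def syn_single)
    then have "card (range (\<lambda>c. syn (single a c))) = ?q" by (simp add: card_image)
    moreover have "range (\<lambda>c. syn (single a c)) \<subseteq> {s. apolar s a a}"
      by (auto simp: apolar_def pol_syn_single)
    ultimately show ?thesis by (subst card_Diff_subset) (auto simp: card_apolar_diagonal)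
  qed
  ultimately show ?thesis by (simp add: card_points)
qed

section \<open>First and second moments of the root count\<close>

lemma sum_card_swap:
  assumes "finite A" "finite B"
  shows "(\<Sum>a\<in>A. card {b \<in> B. Q a b}) = (\<Sum>b\<in>B. card {a \<in> A. Q a b})"
  using sum.swap[of "\<lambda>a b. if Q a b then 1 else 0 :: nat" B A]
  by (simp add: sum_indicator_eq_card assms)

lemma card_syndrome: "card (UNIV :: 'a::finite syndrome set) = card (UNIV :: 'a set) ^ 4"
  by (simp add: UNIV_Times_UNIV[symmetric] card_cartesian_product power4_eq_xxxx del: UNIV_Times_UNIV)

lemma card_pol_root: "card {s :: 'a::{finite,field} syndrome. pol s j j j = 0} = card (UNIV :: 'a set) ^ 3"
proof -
  have cu: "card (UNIV :: ('a \<times> 'a \<times> 'a) set) = card (UNIV :: 'a set) ^ 3"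
    by (simp add: UNIV_Times_UNIV[symmetric] card_cartesian_product power3_eq_cube del: UNIV_Times_UNIV)
  show ?thesis
  proof (cases j)
    case None
    have "{s :: 'a syndrome. pol s j j j = 0} = Pair 0 ` UNIV"
      by (auto simp: None image_iff split_paired_Ex)
    moreover have "inj (Pair (0::'a) :: 'a \<times> 'a \<times> 'a \<Rightarrow> _)" by (auto simp: inj_on_def)
    ultimately show ?thesis by (simp only: card_image cu)
  next
    case (Some t)
    let ?z = "\<lambda>u v w. t * t * t * u - 3 * (t * t * v) + 3 * (t * w)"
    have "pol (u, v, w, x) j j j = 0 \<longleftrightarrow> x = ?z u v w" for u v w x
      unfolding Some by (auto simp: algebra_simps)
    then have "{s :: 'a syndrome. pol s j j j = 0} = (\<lambda>(u, v, w). (u, v, w, ?z u v w)) ` UNIV"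
      by (auto simp: image_iff split_paired_Ex simp del: pol.simps)
    moreover have "inj (\<lambda>(u, v, w). (u, v, w, ?z u v w))" by (auto simp: inj_on_def)
    ultimately show ?thesis by (simp only: card_image cu)
  qed
qed

lemma card_pol_two_roots:
  assumes three: "(3::'a::{finite,field}) \<noteq> 0" and ij: "i \<noteq> j"
  shows "card {s :: 'a syndrome. pol s i i i = 0 \<and> pol s j j j = 0} = card (UNIV :: 'a set) ^ 2"
proof -
  have sq: "card (UNIV :: ('a \<times> 'a) set) = card (UNIV :: 'a set) ^ 2"
    by (simp add: UNIV_Times_UNIV[symmetric] card_cartesian_product power2_eq_square del: UNIV_Times_UNIV)
  let ?x = "\<lambda>t u v w. t * t * t * u - 3 * (t * t * v) + 3 * (t * w)"
  have S: "pol (u, v, w, x) (Some t) (Some t) (Some t) = 0 \<longleftrightarrow> x = ?x t u v w" for t u v w x :: 'a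
    by (auto simp: algebra_simps)
  have N: "pol (u, v, w, x) None None None = 0 \<longleftrightarrow> u = 0" for u v w x :: 'a by simp
  have NS: "card {s :: 'a syndrome. pol s None None None = 0 \<and> pol s (Some t) (Some t) (Some t) = 0} = card (UNIV :: 'a set) ^ 2" for t
  proof -
    have "{s :: 'a syndrome. pol s None None None = 0 \<and> pol s (Some t) (Some t) (Some t) = 0}
        = (\<lambda>(v, w). (0, v, w, ?x t 0 v w)) ` UNIV"
      by (auto simp: S N image_iff split_paired_Ex simp del: pol.simps)
    moreover have "inj (\<lambda>(v, w). (0::'a, v, w, ?x t 0 v w))" by (auto simp: inj_on_def)
    ultimately show ?thesis by (simp only: card_image sq)
  qed
  have SS: "card {s :: 'a syndrome. pol s (Some t) (Some t) (Some t) = 0 \<and> pol s (Some r) (Some r) (Some r) = 0} = card (UNIV :: 'a set) ^ 2"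
    if "t \<noteq> r" for t r
  proof -
    \<comment> \<open>The difference of the two conditions is \<open>t - r\<close> times a linear
      equation in w with leading coefficient 3; solving it divides by 3.\<close>
    let ?w = "\<lambda>u v. (3 * ((t + r) * v) - (t * t + t * r + r * r) * u) / 3"
    have "?x t u v w = ?x r u v w \<longleftrightarrow> w = ?w u v" for u v w
    proof -
      have "?x t u v w - ?x r u v w = (t - r) * (3 * w - (3 * ((t + r) * v) - (t * t + t * r + r * r) * u))"
        by (simp add: algebra_simps)
      then have "?x t u v w = ?x r u v w \<longleftrightarrow> 3 * w = 3 * ((t + r) * v) - (t * t + t * r + r * r) * u"
        using that by (metis eq_iff_diff_eq_0 mult_eq_0_iff)
      then show ?thesis using three by (auto simp: field_simps)
    qed
    then have "pol (u, v, w, x) (Some t) (Some t) (Some t) = 0 \<and> pol (u, v, w, x) (Some r) (Some r) (Some r) = 0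
        \<longleftrightarrow> w = ?w u v \<and> x = ?x t u v (?w u v)" for u v w x unfolding S by metis
    then show ?thesis by (rule card_syndrome_graph)
  qed
  show ?thesis
    using ij NS SS by (cases i; cases j) (auto simp: conj_commute simp del: pol.simps)
qed

lemma sum_nroots:
  "(\<Sum>s\<in>(UNIV :: 'a::{finite,field} syndrome set). nroots s) = (card (UNIV :: 'a set) + 1) * card (UNIV :: 'a set) ^ 3"
proof -
  have "(\<Sum>s\<in>(UNIV :: 'a syndrome set). nroots s) =
      (\<Sum>j\<in>UNIV. card {s \<in> (UNIV :: 'a syndrome set). pol s j j j = 0})"
    using sum_card_swap[of "UNIV :: 'a syndrome set" UNIV "\<lambda>s j. pol s j j j = 0"] by (simp only: nroots_def finite UNIV_I simp_thms)
  also have "\<dots> = (\<Sum>j\<in>(UNIV :: 'a option set). card (UNIV :: 'a set) ^ 3)"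
    by (simp only: UNIV_I simp_thms card_pol_root)
  finally show ?thesis by (simp add: card_points)
qed

text \<open>The summand counts ordered pairs of distinct roots, and each pair of points imposes two
  independent conditions on s.\<close>

lemma sum_nroots_pairs:
  assumes three: "(3::'a::{finite,field}) \<noteq> 0"
  shows "(\<Sum>s\<in>(UNIV :: 'a syndrome set). nroots s * (nroots s - 1)) =
    (card (UNIV :: 'a set) + 1) * card (UNIV :: 'a set) * card (UNIV :: 'a set) ^ 2"
proof -
  let ?P = "{(i, j). i \<in> (UNIV :: 'a option set) \<and> j \<in> UNIV \<and> i \<noteq> j}"
  let ?Q = "\<lambda>(s :: 'a syndrome) (i, j). pol s i i i = 0 \<and> pol s j j j = 0"
  have "nroots s * (nroots s - 1) = card {p \<in> ?P. ?Q s p}" for s :: "'a syndrome"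
  proof -
    have "{p \<in> ?P. ?Q s p} = {(i, j). i \<in> {j. pol s j j j = 0} \<and> j \<in> {j. pol s j j j = 0} \<and> i \<noteq> j}" by auto
    then show ?thesis using card_distinct_pairs[of "{j. pol s j j j = 0}"] by (simp add: nroots_def)
  qed
  then have "(\<Sum>s\<in>(UNIV :: 'a syndrome set). nroots s * (nroots s - 1)) =
      (\<Sum>s\<in>(UNIV :: 'a syndrome set). card {p \<in> ?P. ?Q s p})" by (simp only:)
  also have "\<dots> = (\<Sum>p\<in>?P. card {s \<in> (UNIV :: 'a syndrome set). ?Q s p})"
    by (rule sum_card_swap) simp_all
  also have "\<dots> = (\<Sum>p\<in>?P. card (UNIV :: 'a set) ^ 2)"
  proof (rule sum.cong)
    fix p assume "p \<in> ?P"
    then obtain i j where "p = (i, j)" "i \<noteq> j" by auto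
    then show "card {s \<in> (UNIV :: 'a syndrome set). ?Q s p} = card (UNIV :: 'a set) ^ 2"
      using card_pol_two_roots[OF three, of i j] by (simp del: pol.simps)
  qed simp
  also have "\<dots> = card ?P * card (UNIV :: 'a set) ^ 2" by simp
  finally show ?thesis using card_distinct_pairs[of "UNIV :: 'a option set"] by (simp add: card_points)
qed

section \<open>Distribution of the root count\<close>

text \<open>\<open>xs\<close> pairs each piece of W with its value of g. Since the values are
  distinct, the pieces are exactly the level sets of g.\<close>

lemma distribution_counts_partition:
  fixes g :: "'a::{finite,field} syndrome \<Rightarrow> nat"
  assumes q: "card (UNIV :: 'a set) \<ge> 5" and w: "w = 2 \<or> w = 3"
    and W: "\<And>s. s \<in> W \<longleftrightarrow> coset_weight (fib s) = w"
    and g: "\<And>s. s \<in> W \<Longrightarrow> g s = 6 * weight_distribution (fib s) 3"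
    and xs: "distinct (map snd xs)" "W = \<Union> (fst ` set xs)"
    and ne: "\<And>X v. (X, v) \<in> set xs \<Longrightarrow> X \<noteq> {}"
    and val: "\<And>X v s. (X, v) \<in> set xs \<Longrightarrow> s \<in> X \<Longrightarrow> g s = v"
  shows "distribution_counts (twisted_cubic_code :: ('a option \<Rightarrow> 'a) set) w (map (\<lambda>p. card (fst p)) xs)"
proof (rule distribution_countsI[OF q w W g])
  have memW: "s \<in> W \<longleftrightarrow> (\<exists>X v. (X, v) \<in> set xs \<and> s \<in> X)" for s
    unfolding xs(2) by force
  show "distinct (map snd xs)" by (rule xs)
  show "g ` W = set (map snd xs)"
  proof (intro set_eqI iffI)
    fix v assume "v \<in> g ` W"
    then obtain s where s: "v = g s" "s \<in> W" by blast
    then obtain X u where X: "(X, u) \<in> set xs" "s \<in> X" using memW by blast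
    then have "u = v" using val s(1) by simp
    with X show "v \<in> set (map snd xs)" by (metis image_eqI list.set_map snd_conv)
  next
    fix v assume "v \<in> set (map snd xs)"
    then obtain X where X: "(X, v) \<in> set xs" by auto
    with ne[OF X] obtain s where s: "s \<in> X" by blast
    with X memW have "s \<in> W" by blast
    with val[OF X s] show "v \<in> g ` W" by blast
  qed
  have "{s \<in> W. g s = v} = X" if X: "(X, v) \<in> set xs" for X v
  proof (intro set_eqI iffI)
    fix s assume s: "s \<in> X"
    with X memW have "s \<in> W" by blast
    with val[OF X s] show "s \<in> {s \<in> W. g s = v}" by simp
  next
    fix s assume "s \<in> {s \<in> W. g s = v}"
    then have s: "s \<in> W" "g s = v" by simp_all
    then obtain Y u where Y: "(Y, u) \<in> set xs" "s \<in> Y" using memW by blast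
    with val[OF Y] s have "u = v" by simp
    with xs(1) X Y(1) have "X = Y" unfolding distinct_map inj_on_def by force
    with Y show "s \<in> X" by simp
  qed
  then have "card {s \<in> W. g s = snd p} = card (fst p)" if "p \<in> set xs" for p
    using that by (cases p) simp
  then show "map (\<lambda>v. card {s \<in> W. g s = v}) (map snd xs) = map (\<lambda>p. card (fst p)) xs" by simp
qed

section \<open>Sums over the classes and the moment equations\<close>

lemma sum_classes:
  fixes f :: "'a::{finite,field} syndrome \<Rightarrow> nat"
  assumes q: "card (UNIV :: 'a set) \<ge> 5"
  shows "(\<Sum>s\<in>UNIV. f s) = (\<Sum>s\<in>low. f s) + (\<Sum>s\<in>secant. f s) + (\<Sum>s\<in>tangent. f s) + (\<Sum>s\<in>imaginary. f s)"
proof -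
  have U: "UNIV = low \<union> secant \<union> tangent \<union> (imaginary :: 'a syndrome set)"
    using classes_cover[OF q] by blast
  note d = classes_disjoint[OF q] low_secant_disjoint[OF q]
  have "(low \<union> secant) \<inter> tangent = ({} :: 'a syndrome set)" "(low \<union> secant \<union> tangent) \<inter> imaginary = ({} :: 'a syndrome set)"
    using d by blast+
  with d(6) show ?thesis unfolding U by (simp add: sum.union_disjoint)
qed

text \<open>The other three classes are subtracted from q^4.\<close>

lemma card_imaginary:
  assumes q5: "card (UNIV :: 'a::{finite,field} set) \<ge> 5"
  shows "card (imaginary :: 'a syndrome set) = card (secant :: 'a syndrome set)"
proof -
  define q where "q = card (UNIV :: 'a set)"
  have "q ^ 4 = q ^ 2 + card (secant :: 'a syndrome set) + (q + 1) * (q ^ 2 - q) + card (imaginary :: 'a syndrome set)"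
    using sum_classes[OF q5, of "\<lambda>_. 1"]
    by (simp only: card_eq_sum[symmetric] card_syndrome card_low[OF q5] card_tangent q_def)
  moreover have "2 * card (secant :: 'a syndrome set) = (q + 1) * q * (q - 1) ^ 2"
    using card_secant[OF q5] by (simp only: q_def)
  moreover have "q \<noteq> 0" using q5 q_def by simp
  then obtain p where "q = Suc p" using not0_implies_Suc by blast
  ultimately show ?thesis
    by (simp add: power2_eq_square power4_eq_xxxx algebra_simps)
qed

text \<open>For q at least 5 the triple counts on tangents and imaginary chords are positive, so
  weight 3 is attained there. Writing q as \<open>k + 5\<close> makes the positivity
  visible.\<close>

lemma coset_weight_fib_eq_3_iff_class:
  fixes s :: "'a::{finite,field} syndrome"
  assumes q5: "card (UNIV :: 'a set) \<ge> 5"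
  shows "coset_weight (fib s) = 3 \<longleftrightarrow> s \<in> tangent \<union> imaginary"
proof -
  define q where "q = card (UNIV :: 'a set)"
  then obtain k where k: "q = k + 5" using q5 by (metis le_iff_add add.commute)
  have "card (triples s) > 0" if "s \<in> tangent \<union> imaginary"
    using that card_triples_tangent[of s] card_triples_imaginary[of s]
    unfolding q_def[symmetric] k by (auto simp: algebra_simps)
  then show ?thesis
    unfolding coset_weight_fib_eq_3_iff[OF q5]
    using classes_cover[OF q5, of s] classes_disjoint[OF q5] card_triples[OF q5, of s] by auto
qed

text \<open>On the values 0, 1, 3 the product \<open>N s * (N s - 1)\<close> is 6 at 3 and zero
  elsewhere, so the cardinality and the two sums determine all three frequencies.\<close>

lemma sum_013:
  fixes N :: "'b \<Rightarrow> nat"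
  assumes "finite X" "\<And>s. s \<in> X \<Longrightarrow> N s \<in> {0, 1, 3}"
  shows "card X = card {s \<in> X. N s = 0} + card {s \<in> X. N s = 1} + card {s \<in> X. N s = 3}"
    and "(\<Sum>s\<in>X. N s) = card {s \<in> X. N s = 1} + 3 * card {s \<in> X. N s = 3}"
    and "(\<Sum>s\<in>X. N s * (N s - 1)) = 6 * card {s \<in> X. N s = 3}"
proof -
  let ?i = "\<lambda>k s. if N s = k then 1 else 0 :: nat"
  have c: "(\<Sum>s\<in>X. ?i k s) = card {s \<in> X. N s = k}" for k by (rule sum_indicator_eq_card[OF assms(1)])
  have "card X = (\<Sum>s\<in>X. ?i 0 s + ?i 1 s + ?i 3 s)"
    unfolding card_eq_sum by (rule sum.cong) (use assms(2) in fastforce)+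
  then show "card X = card {s \<in> X. N s = 0} + card {s \<in> X. N s = 1} + card {s \<in> X. N s = 3}"
    by (simp only: sum.distrib c)
  have "(\<Sum>s\<in>X. N s) = (\<Sum>s\<in>X. ?i 1 s + 3 * ?i 3 s)"
    by (rule sum.cong) (use assms(2) in fastforce)+
  then show "(\<Sum>s\<in>X. N s) = card {s \<in> X. N s = 1} + 3 * card {s \<in> X. N s = 3}"
    by (simp only: sum.distrib sum_distrib_left[symmetric] c)
  have "(\<Sum>s\<in>X. N s * (N s - 1)) = (\<Sum>s\<in>X. 6 * ?i 3 s)"
    by (rule sum.cong) (use assms(2) in fastforce)+
  then show "(\<Sum>s\<in>X. N s * (N s - 1)) = 6 * card {s \<in> X. N s = 3}"
    by (simp only: sum_distrib_left[symmetric] c)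
qed

lemma nroots_secant_imaginary_013:
  fixes s :: "'a::{finite,field} syndrome"
  assumes q5: "card (UNIV :: 'a set) \<ge> 5" and three: "(3::'a) \<noteq> 0" and s: "s \<in> secant \<union> imaginary"
  shows "nroots s \<in> {0, 1, 3}"
proof (rule nroots_not_tangent[OF _ three])
  fix a
  have "s \<notin> low" "s \<notin> tangent"
    using s classes_disjoint[OF q5] low_secant_disjoint[OF q5] by blast+
  then show "\<not> apolar s a a" by (auto simp: tangent_def)
qed

text \<open>From the totals over all syndromes subtract the cubic, where the zero syndrome has q + 1
  roots, and the tangents. As X and Y have equal size, both moments average 1 over the remaining
  chords.\<close>

lemma nroots_moments:
  fixes X Y :: "'a::{finite,field} syndrome set"
  assumes q5: "card (UNIV :: 'a set) \<ge> 5" and three: "(3::'a) \<noteq> 0"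
  defines "X \<equiv> secant" and "Y \<equiv> imaginary"
  shows "(\<Sum>s\<in>X. nroots s) + (\<Sum>s\<in>Y. nroots s) = 2 * card X"
    and "(\<Sum>s\<in>X. nroots s * (nroots s - 1)) + (\<Sum>s\<in>Y. nroots s * (nroots s - 1)) = 2 * card X"
proof -
  define q where "q = card (UNIV :: 'a set)"
  have low: "(0 :: 'a syndrome) \<in> low"
    by (rule lowI[of _ None 0]) (simp add: single_def syn_zero)
  have c: "card (low - {0 :: 'a syndrome}) = q ^ 2 - 1"
    using card_low[OF q5] low by (simp add: q_def)
  \<comment> \<open>Stated for arbitrary f because both f x = x and f x = x * (x - 1) are
    needed.\<close>
  have l: "(\<Sum>s\<in>(low :: 'a syndrome set). f (nroots s)) = f (q + 1) + (q ^ 2 - 1) * f 1" for f :: "nat \<Rightarrow> nat"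
  proof -
    have "(\<Sum>s\<in>(low :: 'a syndrome set). f (nroots s)) = f (q + 1) + (\<Sum>s\<in>low - {0 :: 'a syndrome}. f (nroots s))"
      using sum.remove[of low "0 :: 'a syndrome" "\<lambda>s. f (nroots s)"] low by (simp add: nroots_zero q_def)
    also have "(\<Sum>s\<in>low - {0 :: 'a syndrome}. f (nroots s)) = (\<Sum>s\<in>low - {0 :: 'a syndrome}. f 1)"
      by (rule sum.cong) (simp_all add: nroots_low)
    finally show ?thesis using c by simp
  qed
  have t: "(\<Sum>s\<in>(tangent :: 'a syndrome set). f (nroots s)) = (q + 1) * (q ^ 2 - q) * f 2" for f :: "nat \<Rightarrow> nat"
  proof -
    have "(\<Sum>s\<in>(tangent :: 'a syndrome set). f (nroots s)) = (\<Sum>s\<in>(tangent :: 'a syndrome set). f 2)"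
      by (rule sum.cong) (simp_all add: nroots_tangent[OF _ three])
    then show ?thesis by (simp add: card_tangent q_def)
  qed
  have s: "2 * card X = (q + 1) * q * (q - 1) ^ 2"
    using card_secant[OF q5] by (simp only: q_def X_def)
  have "q \<noteq> 0" using q5 q_def by simp
  then obtain p where p: "q = Suc p" using not0_implies_Suc by blast
  have "(q + 1) * q ^ 3 = q + 1 + (q ^ 2 - 1) * 1 + (\<Sum>s\<in>X. nroots s) + (q + 1) * (q ^ 2 - q) * 2 + (\<Sum>s\<in>Y. nroots s)"
    using sum_classes[OF q5, of nroots] sum_nroots[where 'a = 'a] l[of "\<lambda>x. x"] t[of "\<lambda>x. x"]
    by (simp only: q_def X_def Y_def)
  then show "(\<Sum>s\<in>X. nroots s) + (\<Sum>s\<in>Y. nroots s) = 2 * card X"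
    unfolding s p by (simp add: power2_eq_square power3_eq_cube algebra_simps)
  have "(q + 1) * q * q ^ 2 = (q + 1) * (q + 1 - 1) + (q ^ 2 - 1) * (1 * (1 - 1)) + (\<Sum>s\<in>X. nroots s * (nroots s - 1))
      + (q + 1) * (q ^ 2 - q) * (2 * (2 - 1)) + (\<Sum>s\<in>Y. nroots s * (nroots s - 1))"
    using sum_classes[OF q5, of "\<lambda>s. nroots s * (nroots s - 1)"] sum_nroots_pairs[OF three]
      l[of "\<lambda>x. x * (x - 1)"] t[of "\<lambda>x. x * (x - 1)"]
    by (simp only: q_def X_def Y_def)
  then show "(\<Sum>s\<in>X. nroots s * (nroots s - 1)) + (\<Sum>s\<in>Y. nroots s * (nroots s - 1)) = 2 * card X"
    unfolding s p by (simp add: power2_eq_square algebra_simps)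
qed

text \<open>Let m be the common size of the two chord classes. The second moment yields m/3
  syndromes with three roots, and the first then yields m with one root. None of the latter lies on
  a real chord, so they fill the imaginary class.\<close>

lemma nroots_distribution_mod_1:
  assumes q5: "card (UNIV :: 'a::{finite,field} set) \<ge> 5" and q: "card (UNIV :: 'a set) mod 3 = 1"
  shows "3 * card {s \<in> (secant :: 'a syndrome set). nroots s = 3} = card (secant :: 'a syndrome set)"
    and "3 * card {s \<in> (secant :: 'a syndrome set). nroots s = 0} = 2 * card (secant :: 'a syndrome set)"
    and "s \<in> (secant :: 'a syndrome set) \<Longrightarrow> nroots s = 0 \<or> nroots s = 3"
    and "s \<in> (imaginary :: 'a syndrome set) \<Longrightarrow> nroots s = 1"
proof -
  have three: "(3::'a) \<noteq> 0" using q three_eq_0_iff[where 'a = 'a] by simp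
  obtain \<omega> :: 'a where w: "\<omega> ^ 3 = 1" "\<omega> \<noteq> 1" using ex_cube_root_of_unity[OF q] by blast
  note n013 = nroots_secant_imaginary_013[OF q5 three]
  have ne1: "nroots s \<noteq> 1" if "s \<in> secant" for s :: "'a syndrome"
    using nroots_secant_of_cube_root_of_unity[OF q5 that w] .
  then show "s \<in> (secant :: 'a syndrome set) \<Longrightarrow> nroots s = 0 \<or> nroots s = 3"
    using n013[of s] by auto
  have z: "card {s \<in> (secant :: 'a syndrome set). nroots s = 1} = 0" using ne1 by auto
  have X: "\<And>s. s \<in> (secant :: 'a syndrome set) \<Longrightarrow> nroots s \<in> {0, 1, 3}"
    and Y: "\<And>s. s \<in> (imaginary :: 'a syndrome set) \<Longrightarrow> nroots s \<in> {0, 1, 3}" using n013 by blast+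
  note eqs = sum_013[OF finite[of "secant :: 'a syndrome set"], of nroots, OF X] sum_013[OF finite[of "imaginary :: 'a syndrome set"], of nroots, OF Y] nroots_moments[OF q5 three] card_imaginary[OF q5] z
  show "3 * card {s \<in> (secant :: 'a syndrome set). nroots s = 3} = card (secant :: 'a syndrome set)"
    "3 * card {s \<in> (secant :: 'a syndrome set). nroots s = 0} = 2 * card (secant :: 'a syndrome set)"
    using eqs by linarith+
  have "card {s \<in> (imaginary :: 'a syndrome set). nroots s = 0} = 0"
    "card {s \<in> (imaginary :: 'a syndrome set). nroots s = 3} = 0"
    using eqs by linarith+
  then show "s \<in> (imaginary :: 'a syndrome set) \<Longrightarrow> nroots s = 1" using Y[of s] by auto
qed

text \<open>Here all real chords have one root, so the same equations leave none with one root on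
  imaginary chords and force the split into 0 and 3 roots there.\<close>

lemma nroots_distribution_mod_2:
  assumes q5: "card (UNIV :: 'a::{finite,field} set) \<ge> 5" and q: "card (UNIV :: 'a set) mod 3 = 2"
  shows "3 * card {s \<in> (imaginary :: 'a syndrome set). nroots s = 3} = card (secant :: 'a syndrome set)"
    and "3 * card {s \<in> (imaginary :: 'a syndrome set). nroots s = 0} = 2 * card (secant :: 'a syndrome set)"
    and "s \<in> (imaginary :: 'a syndrome set) \<Longrightarrow> nroots s = 0 \<or> nroots s = 3"
proof -
  have three: "(3::'a) \<noteq> 0" using q three_eq_0_iff[where 'a = 'a] by simp
  note n013 = nroots_secant_imaginary_013[OF q5 three]
  have "inj (\<lambda>x::'a. x ^ 3)" using q by (intro inj_cube) simp
  then have one: "nroots s = 1" if "s \<in> secant" for s :: "'a syndrome"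
    using nroots_secant_of_bij_cube[OF q5 that] by blast
  have z: "card {s \<in> (secant :: 'a syndrome set). nroots s = 0} = 0"
    "card {s \<in> (secant :: 'a syndrome set). nroots s = 3} = 0" using one by auto
  have X: "\<And>s. s \<in> (secant :: 'a syndrome set) \<Longrightarrow> nroots s \<in> {0, 1, 3}"
    and Y: "\<And>s. s \<in> (imaginary :: 'a syndrome set) \<Longrightarrow> nroots s \<in> {0, 1, 3}" using n013 by blast+
  note eqs = sum_013[OF finite[of "secant :: 'a syndrome set"], of nroots, OF X] sum_013[OF finite[of "imaginary :: 'a syndrome set"], of nroots, OF Y] nroots_moments[OF q5 three] card_imaginary[OF q5] z
  show "3 * card {s \<in> (imaginary :: 'a syndrome set). nroots s = 3} = card (secant :: 'a syndrome set)"
    "3 * card {s \<in> (imaginary :: 'a syndrome set). nroots s = 0} = 2 * card (secant :: 'a syndrome set)"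
    using eqs by linarith+
  have "card {s \<in> (imaginary :: 'a syndrome set). nroots s = 1} = 0" using eqs by linarith
  then show "s \<in> (imaginary :: 'a syndrome set) \<Longrightarrow> nroots s = 0 \<or> nroots s = 3" using Y[of s] by auto
qed

text \<open>The cubic form vanishes identically exactly on the q^2 syndromes with
  \<open>s0 = s3 = 0\<close>. The nonzero ones lie on tangents, so everything on imaginary chords
  has one root.\<close>

lemma nroots_distribution_mod_0:
  assumes q5: "card (UNIV :: 'a::{finite,field} set) \<ge> 5" and q: "card (UNIV :: 'a set) mod 3 = 0"
  shows "card {s \<in> (tangent :: 'a syndrome set). nroots s \<noteq> 1} = card (UNIV :: 'a set) ^ 2 - 1"
    and "s \<in> (tangent :: 'a syndrome set) \<Longrightarrow> nroots s \<noteq> 1 \<Longrightarrow> nroots s = card (UNIV :: 'a set) + 1"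
    and "s \<in> (imaginary :: 'a syndrome set) \<Longrightarrow> nroots s = 1"
proof -
  have three: "(3::'a) = 0" using q three_eq_0_iff[where 'a = 'a] by simp
  have "inj (\<lambda>x::'a. x ^ 3)" using q by (intro inj_cube) simp
  note n = nroots_char3[OF three this]
  have n': "nroots s = card (UNIV :: 'a set) + 1 \<or> nroots s = 1" for s :: "'a syndrome"
    by (cases s) (simp add: n)
  then show "s \<in> (tangent :: 'a syndrome set) \<Longrightarrow> nroots s \<noteq> 1 \<Longrightarrow> nroots s = card (UNIV :: 'a set) + 1" by blast
  have iff: "s \<in> tangent \<and> nroots s \<noteq> 1 \<longleftrightarrow> s \<noteq> 0 \<and> (\<exists>u v. s = (0, u, v, 0))" for s :: "'a syndrome"
  proof
    assume t: "s \<in> tangent \<and> nroots s \<noteq> 1"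
    obtain s0 s1 s2 s3 where s: "s = (s0, s1, s2, s3)" by (cases s)
    have "s0 = 0 \<and> s3 = 0" using t unfolding s n by (auto split: if_splits)
    moreover have "s \<noteq> 0" using t lowI[of 0 None 0] by (auto simp: tangent_def single_def syn_zero)
    ultimately show "s \<noteq> 0 \<and> (\<exists>u v. s = (0, u, v, 0))" using s by blast
  next
    assume "s \<noteq> 0 \<and> (\<exists>u v. s = (0, u, v, 0))"
    then obtain u v where s: "s = (0, u, v, 0)" "s \<noteq> 0" by blast
    then have "u \<noteq> 0 \<or> v \<noteq> 0" by (auto simp: zero_prod_def)
    with s show "s \<in> tangent \<and> nroots s \<noteq> 1" using q5 by (simp add: n tangent_of_char3[OF three])
  qed
  have "{s \<in> (tangent :: 'a syndrome set). nroots s \<noteq> 1} = (\<lambda>(u, v). (0, u, v, 0)) ` UNIV - {0}"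
    unfolding iff by (auto simp: image_iff split_paired_Ex)
  also have "card \<dots> = card ((\<lambda>(u, v). (0 :: 'a, u :: 'a, v :: 'a, 0 :: 'a)) ` UNIV) - 1"
    by (rule card_Diff_singleton) (auto simp: image_iff split_paired_Ex zero_prod_def)
  also have "card ((\<lambda>(u, v). (0 :: 'a, u :: 'a, v :: 'a, 0 :: 'a)) ` UNIV) = card (UNIV :: ('a \<times> 'a) set)"
    by (rule card_image) (auto simp: inj_on_def)
  also have "\<dots> = card (UNIV :: 'a set) ^ 2"
    by (simp add: UNIV_Times_UNIV[symmetric] card_cartesian_product power2_eq_square del: UNIV_Times_UNIV)
  finally show "card {s \<in> (tangent :: 'a syndrome set). nroots s \<noteq> 1} = card (UNIV :: 'a set) ^ 2 - 1" .
  show "nroots s = 1" if "s \<in> (imaginary :: 'a syndrome set)" for s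
  proof (rule ccontr)
    assume "nroots s \<noteq> 1"
    obtain s0 s1 s2 s3 where s: "s = (s0, s1, s2, s3)" by (cases s)
    have "s0 = 0 \<and> s3 = 0" using \<open>nroots s \<noteq> 1\<close> unfolding s n by (auto split: if_splits)
    moreover have "s \<noteq> 0" using that lowI[of 0 None 0] by (auto simp: imaginary_def single_def syn_zero)
    ultimately have "s \<in> tangent" using s iff[of s] by blast
    with that classes_disjoint(5)[OF q5] show False by blast
  qed
qed

text \<open>m is the common size of the real and imaginary chord classes; these identities turn
  class sizes into the closed forms of the theorem. Putting q = \<open>Suc p\<close> removes
  truncated subtraction.\<close>

lemma twisted_cubic_counts:
  fixes q :: nat
  assumes q5: "q \<ge> 5" and m: "2 * m = (q + 1) * q * (q - 1) ^ 2"
  shows "(q ^ 3 - q) * (q - 1) = 2 * m"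
    and "(q + 1) * (q ^ 2 - q) = (q ^ 2 + q) * (q - 1)"
    and "(q + 1) * (q ^ 2 - q) - (q ^ 2 - 1) = (q ^ 2 - 1) * (q - 1)"
    and "(q + 1) * (q ^ 2 - q + 2) * (q - 1) = 2 * (q ^ 2 - 1 + m)"
proof -
  obtain p where p: "q = Suc p" using q5 by (cases q) auto
  have s: "q ^ 2 - q = q * p" "q ^ 2 - 1 = (q + 1) * p" "q ^ 3 - q = (q + 1) * q * p"
    unfolding p by (simp_all add: power2_eq_square power3_eq_cube algebra_simps)
  show "(q ^ 3 - q) * (q - 1) = 2 * m" unfolding s m by (simp add: p power2_eq_square algebra_simps)
  show "(q + 1) * (q ^ 2 - q) = (q ^ 2 + q) * (q - 1)" unfolding s by (simp add: p power2_eq_square algebra_simps)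
  show "(q + 1) * (q ^ 2 - q) - (q ^ 2 - 1) = (q ^ 2 - 1) * (q - 1)"
    unfolding s by (simp add: p algebra_simps)
  show "(q + 1) * (q ^ 2 - q + 2) * (q - 1) = 2 * (q ^ 2 - 1 + m)"
    unfolding distrib_left m s by (simp add: p power2_eq_square algebra_simps)
qed

text \<open>In terms of q the three constants are (q - 1)(q - 4), q^2 - 3q - 2 and (q + 1)(q - 2).
  With q written as \<open>k + 5\<close> they contain no subtraction.\<close>

lemma card_triples_values:
  fixes s :: "'a::{finite,field} syndrome"
  assumes q: "card (UNIV :: 'a set) = k + 5"
  shows "s \<in> secant \<Longrightarrow> card (triples s) = (k + 4) * (k + 1) + 2 * nroots s"
    and "s \<in> tangent \<Longrightarrow> card (triples s) = k * k + 7 * k + 8 + 2 * nroots s"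
    and "s \<in> imaginary \<Longrightarrow> card (triples s) = k * k + 9 * k + 18 + 2 * nroots s"
proof -
  have q5: "card (UNIV :: 'a set) \<ge> 5" using q by simp
  show "s \<in> secant \<Longrightarrow> card (triples s) = (k + 4) * (k + 1) + 2 * nroots s"
    using card_triples_secant[OF q5, of s] unfolding q by (simp add: algebra_simps)
  show "s \<in> tangent \<Longrightarrow> card (triples s) = k * k + 7 * k + 8 + 2 * nroots s"
    using card_triples_tangent[of s] unfolding q by (simp add: algebra_simps)
  show "s \<in> imaginary \<Longrightarrow> card (triples s) = k * k + 9 * k + 18 + 2 * nroots s"
    using card_triples_imaginary[of s] unfolding q by (simp add: algebra_simps)
qed

theorem theorem3p6:
  fixes C :: "('a::{finite,field} option \<Rightarrow> 'a) set"
  defines "C \<equiv> (twisted_cubic_code :: ('a option \<Rightarrow> 'a) set)"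
    and "q \<equiv> card (UNIV :: 'a set)"
  assumes q5: "q \<ge> 5"
  shows
    "(\<forall>S\<in>cosets_of_weight C 1. \<forall>T\<in>cosets_of_weight C 1.
        weight_distribution S = weight_distribution T)
   \<and> (q mod 3 \<noteq> 1 \<longrightarrow> (\<forall>S\<in>cosets_of_weight C 2. \<forall>T\<in>cosets_of_weight C 2.
        weight_distribution S = weight_distribution T))
   \<and> (q mod 3 = 1 \<longrightarrow> distribution_counts C 2
        [(q^3 - q) * (q - 1) div 3, (q^3 - q) * (q - 1) div 6])
   \<and> (q mod 3 = 1 \<longrightarrow> distribution_counts C 3
        [(q^2 + q) * (q - 1), (q^3 - q) * (q - 1) div 2])
   \<and> (q mod 3 = 2 \<longrightarrow> distribution_counts C 3
        [(q^2 + q) * (q - 1), (q^3 - q) * (q - 1) div 3, (q^3 - q) * (q - 1) div 6])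
   \<and> (q mod 3 = 0 \<longrightarrow> distribution_counts C 3
        [(q^2 - 1) * (q - 1), (q + 1) * (q^2 - q + 2) * (q - 1) div 2])"
proof -
  let ?sec = "secant :: 'a syndrome set" and ?tan = "tangent :: 'a syndrome set"
    and ?im = "imaginary :: 'a syndrome set"
  define m where "m = card ?sec"
  have q5': "card (UNIV :: 'a set) \<ge> 5" using q5 by (simp only: q_def)
  obtain k where "q = 5 + k" using q5 le_Suc_ex by blast
  then have k: "card (UNIV :: 'a set) = k + 5" by (simp add: q_def)
  note vals = card_triples_values[OF k]
  have m2: "2 * m = (q + 1) * q * (q - 1) ^ 2" unfolding m_def q_def by (rule card_secant[OF q5'])
  note arith = twisted_cubic_counts[OF q5 m2]
  have "m > 0"
  proof (rule ccontr)
    assume "\<not> m > 0"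
    then have "(q + 1) * q * (q - 1) ^ 2 = 0" using m2 by simp
    with q5 show False by simp
  qed
  then have im: "card ?im = m" "?im \<noteq> {}" using card_imaginary[OF q5'] by (auto simp: m_def)
  have tan: "card ?tan = (q ^ 2 + q) * (q - 1)"
    unfolding arith(2)[symmetric] unfolding q_def by (rule card_tangent)
  then have "card ?tan \<noteq> 0" using q5 by simp
  then have "?tan \<noteq> {}" by auto
  have W2: "s \<in> secant \<longleftrightarrow> coset_weight (fib s) = 2" for s :: "'a syndrome"
    using coset_weight_fib_eq_2_iff[OF q5'] by simp
  have W3: "s \<in> tangent \<union> imaginary \<longleftrightarrow> coset_weight (fib s) = 3" for s :: "'a syndrome"
    using coset_weight_fib_eq_3_iff_class[OF q5'] by simp
  \<comment> \<open>The separating invariant is \<open>card (triples s)\<close>, six times the entry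
    of index 3.\<close>
  note part2 = distribution_counts_partition[OF q5' _ W2 card_triples[OF q5'], folded C_def]
  note part3 = distribution_counts_partition[OF q5' _ W3 card_triples[OF q5'], folded C_def]
  have cw: "cosets_of_weight C w = fib ` {s. coset_weight (fib s) = w}" for w
    unfolding C_def by (rule cosets_of_weight_eq[OF q5'])
  have i: "\<forall>S\<in>cosets_of_weight C 1. \<forall>T\<in>cosets_of_weight C 1. weight_distribution S = weight_distribution T"
    unfolding cw using weight_distribution_coset_weight_1[OF q5'] by blast
  have ii: "weight_distribution S = weight_distribution T"
    if q: "q mod 3 \<noteq> 1" and ST: "S \<in> cosets_of_weight C 2" "T \<in> cosets_of_weight C 2" for S T
  proof -
    obtain s t where st: "S = fib s" "T = fib t" "coset_weight (fib s) = 2" "coset_weight (fib t) = 2"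
      using ST unfolding cw by blast
    \<comment> \<open>With cubing injective every real-chord syndrome has one root, hence the same
      triple count.\<close>
    have inj: "inj (\<lambda>x::'a. x ^ 3)" using q by (intro inj_cube) (simp add: q_def)
    have "s \<in> secant" "t \<in> secant" using W2 st by blast+
    with nroots_secant_of_bij_cube[OF q5' _ inj] have "card (triples s) = card (triples t)"
      by (simp add: vals(1))
    then have "weight_distribution (fib s) 3 = weight_distribution (fib t) 3"
      by (simp add: card_triples[OF q5'])
    then show ?thesis using weight_distribution_eq_iff[OF q5', of 2 s t] st by simp
  qed
  have ii1: "distribution_counts C 2 [(q^3 - q) * (q - 1) div 3, (q^3 - q) * (q - 1) div 6]"
    if q: "q mod 3 = 1"
  proof -
    note n = nroots_distribution_mod_1[OF q5' q[unfolded q_def], folded m_def]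
    \<comment> \<open>Real chords split by 0 or 3 roots into 2m/3 and m/3 syndromes; three roots add
      6 to the triple count.\<close>
    let ?A = "{s \<in> ?sec. nroots s = 0}" and ?B = "{s \<in> ?sec. nroots s = 3}"
    have "distribution_counts C 2 (map (\<lambda>p. card (fst p)) [(?A, (k + 4) * (k + 1)), (?B, (k + 4) * (k + 1) + 6)])"
    proof (rule part2)
      show "?sec = \<Union> (fst ` set [(?A, (k + 4) * (k + 1)), (?B, (k + 4) * (k + 1) + 6)])"
        using n(3) by auto
      have "card ?A \<noteq> 0" "card ?B \<noteq> 0" using n(1,2) \<open>m > 0\<close> by linarith+
      then have "?A \<noteq> {}" "?B \<noteq> {}" by (metis card.empty)+
      then show "X \<noteq> {}" if "(X, v) \<in> set [(?A, (k + 4) * (k + 1)), (?B, (k + 4) * (k + 1) + 6)]" for X v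
        using that by auto
      show "card (triples s) = v"
        if "(X, v) \<in> set [(?A, (k + 4) * (k + 1)), (?B, (k + 4) * (k + 1) + 6)]" "s \<in> X" for X v s
        using that vals(1)[of s] by auto
    qed auto
    moreover have "card ?A = (q^3 - q) * (q - 1) div 3" "card ?B = (q^3 - q) * (q - 1) div 6"
      unfolding arith(1) using n(1,2) by linarith+
    ultimately show ?thesis by simp
  qed
  have iii1: "distribution_counts C 3 [(q^2 + q) * (q - 1), (q^3 - q) * (q - 1) div 2]"
    if q: "q mod 3 = 1"
  proof -
    have three: "(3::'a) \<noteq> 0" using q three_eq_0_iff[where 'a = 'a] by (simp add: q_def)
    note n = nroots_distribution_mod_1(4)[OF q5' q[unfolded q_def]]
    \<comment> \<open>Tangents have two roots (8 + 4 = 12) and imaginary chords one (18 + 2 =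
      20).\<close>
    let ?xs = "[(?tan, k * k + 7 * k + 12), (?im, k * k + 9 * k + 20)]"
    have "distribution_counts C 3 (map (\<lambda>p. card (fst p)) ?xs)"
    proof (rule part3)
      show "X \<noteq> {}" if "(X, v) \<in> set ?xs" for X v
        using that im \<open>?tan \<noteq> {}\<close> by auto
      show "card (triples s) = v" if "(X, v) \<in> set ?xs" "s \<in> X" for X v s
        using that vals(2,3)[of s] n[of s] nroots_tangent[OF _ three, of s] by auto
    qed auto
    moreover have "(q^3 - q) * (q - 1) div 2 = m" unfolding arith(1) by simp
    ultimately show ?thesis by (simp only: list.map fst_conv tan im)
  qed
  have iii2: "distribution_counts C 3 [(q^2 + q) * (q - 1), (q^3 - q) * (q - 1) div 3, (q^3 - q) * (q - 1) div 6]"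
    if q: "q mod 3 = 2"
  proof -
    have three: "(3::'a) \<noteq> 0" using q three_eq_0_iff[where 'a = 'a] by (simp add: q_def)
    note n = nroots_distribution_mod_2[OF q5' q[unfolded q_def], folded m_def]
    let ?A = "{s \<in> ?im. nroots s = 0}" and ?B = "{s \<in> ?im. nroots s = 3}"
    \<comment> \<open>Tangents have two roots; imaginary chords have 0 or 3, giving the constants 18
      and 18 + 6.\<close>
    let ?xs = "[(?tan, k * k + 7 * k + 12), (?A, k * k + 9 * k + 18), (?B, k * k + 9 * k + 24)]"
    have "distribution_counts C 3 (map (\<lambda>p. card (fst p)) ?xs)"
    proof (rule part3)
      have "card ?A \<noteq> 0" "card ?B \<noteq> 0" using n(1,2) \<open>m > 0\<close> by linarith+
      then have "?A \<noteq> {}" "?B \<noteq> {}" by (metis card.empty)+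
      then show "X \<noteq> {}" if "(X, v) \<in> set ?xs" for X v
        using that \<open>?tan \<noteq> {}\<close> by auto
      show "?tan \<union> ?im = \<Union> (fst ` set ?xs)" using n(3) by auto
      show "card (triples s) = v" if "(X, v) \<in> set ?xs" "s \<in> X" for X v s
        using that vals(2,3)[of s] nroots_tangent[OF _ three, of s] by auto
    qed auto
    moreover have "card ?A = (q^3 - q) * (q - 1) div 3" "card ?B = (q^3 - q) * (q - 1) div 6"
      unfolding arith(1) using n(1,2) by linarith+
    ultimately show ?thesis by (simp only: list.map fst_conv tan)
  qed
  have iii0: "distribution_counts C 3 [(q^2 - 1) * (q - 1), (q + 1) * (q^2 - q + 2) * (q - 1) div 2]"
    if q: "q mod 3 = 0"
  proof -
    note n = nroots_distribution_mod_0[OF q5' q[unfolded q_def], folded q_def]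
    let ?A = "{s \<in> ?tan. nroots s = 1}" and ?A' = "{s \<in> ?tan. nroots s \<noteq> 1}"
    \<comment> \<open>Tangents with one root have constant 8 + 2. Those with q + 1 = k + 6 roots
      gain 2k + 12, which gives exactly the value of imaginary chords with one root, so these two
      classes share a weight distribution.\<close>
    let ?xs = "[(?A, k * k + 7 * k + 10), (?A' \<union> ?im, k * k + 9 * k + 20)]"
    have "?tan = ?A \<union> ?A'" by blast
    moreover have "card (?A \<union> ?A') = card ?A + card ?A'" by (rule card_Un_disjoint) auto
    ultimately have "card ?A = (q + 1) * (q ^ 2 - q) - (q ^ 2 - 1)" using n(1) tan arith(2) by simp
    then have A: "card ?A = (q ^ 2 - 1) * (q - 1)" unfolding arith(3) .
    have "card (?A' \<union> ?im) = card ?A' + card ?im"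
      using classes_disjoint(5)[OF q5'] by (intro card_Un_disjoint) auto
    then have B: "card (?A' \<union> ?im) = (q + 1) * (q^2 - q + 2) * (q - 1) div 2"
      unfolding arith(4) n(1) im(1) by simp
    have "distribution_counts C 3 (map (\<lambda>p. card (fst p)) ?xs)"
    proof (rule part3)
      have "q ^ 2 - 1 \<noteq> 0" using q5 power_mono[of 5 q 2] by simp
      then have "card ?A \<noteq> 0" unfolding A using q5 by simp
      then have "?A \<noteq> {}" by (metis card.empty)
      then show "X \<noteq> {}" if "(X, v) \<in> set ?xs" for X v
        using that im by auto
      show "?tan \<union> ?im = \<Union> (fst ` set ?xs)" by auto
      show "card (triples s) = v" if "(X, v) \<in> set ?xs" "s \<in> X" for X v s
        using that vals(2,3)[of s] n(2,3)[of s] k by (auto simp: q_def)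
    qed auto
    then show ?thesis by (simp only: list.map fst_conv A B)
  qed
  show ?thesis using i ii ii1 iii1 iii2 iii0 by blast
qed

end
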